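(* Let $a,b\in\mathbb{R}$ with $a<b$ and $I:=(a,b)$. Let $\bar p_\infty\in L^\infty(I)\setminus\{0\}$ be real-valued with $\bar p_\infty\ge0$ a.e., and let $\bar p_1,\bar p_2,\dots$ be a sequence in $\mathcal{L}$ such that $\lim_{\nu\to\infty}\|\bar p_\nu-\bar p_\infty\|_1=0$. Let $A_\nu:=A_{\bar p_\nu}$ be the associated self-adjoint operators and $p_\nu:=1/\bar p_\nu$ for $\nu\in\{1,2,\dots\}$. Then the sequences $A_1^{-1},A_2^{-1},\dots$ and $-p_1D_I^*A_1^{-1},-p_2D_I^*A_2^{-1},\dots$ converge in the operator norm of the space $L(L^2_{\mathbb{C}}(I),L^2_{\mathbb{C}}(I))$ of bounded linear operators to $B$ and $C$, respectively, where $B,C\in L(L^2_{\mathbb{C}}(I),L^2_{\mathbb{C}}(I))$ are given by $$(Bf)(x)=-\int_a^x\left[\int_y^x\bar p_\infty(u)\,du\right]f(y)\,dy+\|\bar p_\infty\|_1^{-1}\int_a^x\bar p_\infty(y)\,dy\,\int_a^b\left[\int_y^b\bar p_\infty(x')\,dx'\right]f(y)\,dy,$$ $$(Cf)(x)=-\int_a^xf(y)\,dy+\|\bar p_\infty\|_1^{-1}\int_a^b\left[\int_y^b\bar p_\infty(x')\,dx'\right]f(y)\,dy$$ for all $x\in I$ and every $f\in L^2_{\mathbb{C}}(I)$.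
   Context: $L^2_{\mathbb{C}}(I)$ is the Hilbert space of complex-valued square-integrable functions on $I$; $\|\cdot\|_1$ is the $L^1(I)$-norm. $D_I:C_0^\infty(I,\mathbb{C})\to L^2_{\mathbb{C}}(I)$, $D_If=f'$, is a densely-defined operator in $L^2_{\mathbb{C}}(I)$, with Hilbert space adjoint $D_I^*$; its domain is the Sobolev space $D(D_I^* )=W^1_{\mathbb{C}}(I)$, and $-D_I^*$ is the weak derivative. $W^1_{0,\mathbb{C}}(I)$ is the closure of $C_0^\infty(I,\mathbb{C})$ in $W^1_{\mathbb{C}}(I)$ with respect to the norm $(\|f\|_2^2+\|D_I^*f\|_2^2)^{1/2}$. $\mathcal{L}$ is the set of real-valued $\bar p\in L^\infty(I)$ for which there are real $C_2\ge C_1>0$ with $C_1\le\bar p\le C_2$ a.e. on $I$. For $\bar p\in\mathcal{L}$, $A_{\bar p}$ is the operator in $L^2_{\mathbb{C}}(I)$ with domain $D(A_{\bar p})=\{u\in W^1_{0,\mathbb{C}}(I):(1/\bar p)D_I^*u\in D(D_I^* )\}$ and $A_{\bar p}u=-D_I^*\,(1/\bar p)\,D_I^*u$ (i.e. $-((1/\bar p)u')'$ in the weak sense). It is self-adjoint and bijective with bounded inverse. *)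

theory Defs
  imports "HOL-Analysis.Analysis"
begin

text \<open>
  Elements of \<open>L\<^sup>2\<close> are classes of square-integrable functions modulo equality almost
  everywhere. The vector space operations and the norm are computed on a chosen representative;
  the results do not depend on the choice.
\<close>

definition sq_integrable :: "'a measure \<Rightarrow> ('a \<Rightarrow> complex) set" where
  "sq_integrable M = {f \<in> borel_measurable M. integrable M (\<lambda>x. (cmod (f x))\<^sup>2)}"

definition ae_class :: "'a measure \<Rightarrow> ('a \<Rightarrow> complex) \<Rightarrow> ('a \<Rightarrow> complex) set" where
  "ae_class M f = {g \<in> borel_measurable M. AE x in M. g x = f x}"

definition L2 :: "'a measure \<Rightarrow> ('a \<Rightarrow> complex) set set" where
  "L2 M = ae_class M ` sq_integrable M"

definition rep :: "('a \<Rightarrow> complex) set \<Rightarrow> 'a \<Rightarrow> complex" where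
  "rep X = (SOME f. f \<in> X)"

definition l2_add ::
    "'a measure \<Rightarrow> ('a \<Rightarrow> complex) set \<Rightarrow> ('a \<Rightarrow> complex) set \<Rightarrow> ('a \<Rightarrow> complex) set" where
  "l2_add M X Y = ae_class M (\<lambda>x. rep X x + rep Y x)"

definition l2_scale ::
    "'a measure \<Rightarrow> complex \<Rightarrow> ('a \<Rightarrow> complex) set \<Rightarrow> ('a \<Rightarrow> complex) set" where
  "l2_scale M c X = ae_class M (\<lambda>x. c * rep X x)"

definition l2_diff ::
    "'a measure \<Rightarrow> ('a \<Rightarrow> complex) set \<Rightarrow> ('a \<Rightarrow> complex) set \<Rightarrow> ('a \<Rightarrow> complex) set" where
  "l2_diff M X Y = l2_add M X (l2_scale M (-1) Y)"

definition l2_inner ::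
    "'a measure \<Rightarrow> ('a \<Rightarrow> complex) set \<Rightarrow> ('a \<Rightarrow> complex) set \<Rightarrow> complex" where
  "l2_inner M X Y = (LINT x|M. cnj (rep X x) * rep Y x)"

definition l2_norm :: "'a measure \<Rightarrow> ('a \<Rightarrow> complex) set \<Rightarrow> real" where
  "l2_norm M X = sqrt (LINT x|M. (cmod (rep X x))\<^sup>2)"

text \<open>
  Operators in \<open>L\<^sup>2\<close>, bounded or not, are identified with their graphs. Hence \<open>Domain T\<close> is the
  domain of \<open>T\<close>, \<open>T\<inverse>\<close> is the inverse operator, and \<open>S O T\<close> is \<open>S\<close> followed by \<open>T\<close>, with its
  natural domain.
\<close>

type_synonym 'a l2_op = "(('a \<Rightarrow> complex) set \<times> ('a \<Rightarrow> complex) set) set"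

definition op_apply :: "'a l2_op \<Rightarrow> ('a \<Rightarrow> complex) set \<Rightarrow> ('a \<Rightarrow> complex) set" where
  "op_apply T X = (THE Y. (X, Y) \<in> T)"

definition op_uminus :: "'a measure \<Rightarrow> 'a l2_op \<Rightarrow> 'a l2_op" where
  "op_uminus M T = {(X, l2_scale M (-1) Y) | X Y. (X, Y) \<in> T}"

definition op_diff :: "'a measure \<Rightarrow> 'a l2_op \<Rightarrow> 'a l2_op \<Rightarrow> 'a l2_op" where
  "op_diff M S T = {(X, l2_diff M Y Z) | X Y Z. (X, Y) \<in> S \<and> (X, Z) \<in> T}"

definition op_adjoint :: "'a measure \<Rightarrow> 'a l2_op \<Rightarrow> 'a l2_op" where
  "op_adjoint M T =
     {(G, H). G \<in> L2 M \<and> H \<in> L2 M \<and> (\<forall>(X, Y) \<in> T. l2_inner M G Y = l2_inner M H X)}"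

definition op_mult :: "'a measure \<Rightarrow> ('a \<Rightarrow> real) \<Rightarrow> 'a l2_op" where
  "op_mult M m =
     {(X, Y). X \<in> L2 M \<and> Y \<in> L2 M \<and> Y = ae_class M (\<lambda>x. complex_of_real (m x) * rep X x)}"

definition linear_op :: "'a measure \<Rightarrow> 'a l2_op \<Rightarrow> bool" where
  "linear_op M T \<longleftrightarrow>
     (\<forall>(X, Y) \<in> T. \<forall>(X', Y') \<in> T. (l2_add M X X', l2_add M Y Y') \<in> T) \<and>
     (\<forall>c. \<forall>(X, Y) \<in> T. (l2_scale M c X, l2_scale M c Y) \<in> T)"

definition bounded_ops :: "'a measure \<Rightarrow> 'a l2_op set" where
  "bounded_ops M =
     {T. T \<subseteq> L2 M \<times> L2 M \<and> Domain T = L2 M \<and> single_valued T \<and> linear_op M T \<and>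
         (\<exists>K. \<forall>(X, Y) \<in> T. l2_norm M Y \<le> K * l2_norm M X)}"

text \<open>This is the operator norm only on \<^term>\<open>bounded_ops M\<close>.\<close>

definition op_norm :: "'a measure \<Rightarrow> 'a l2_op \<Rightarrow> real" where
  "op_norm M T = Sup {l2_norm M Y | X Y. (X, Y) \<in> T \<and> l2_norm M X \<le> 1}"

definition op_tendsto :: "'a measure \<Rightarrow> (nat \<Rightarrow> 'a l2_op) \<Rightarrow> 'a l2_op \<Rightarrow> bool" where
  "op_tendsto M T S \<longleftrightarrow> (\<lambda>n. op_norm M (op_diff M (T n) S)) \<longlonglongrightarrow> 0"

definition vderiv :: "(real \<Rightarrow> complex) \<Rightarrow> real \<Rightarrow> complex" where
  "vderiv f = (\<lambda>x. vector_derivative f (at x))"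

definition smooth :: "(real \<Rightarrow> complex) \<Rightarrow> bool" where
  "smooth f \<longleftrightarrow> (\<forall>n x. (vderiv ^^ n) f differentiable (at x))"

text \<open>Functions in \<open>C\<^sub>0\<^sup>\<infinity>(I, \<complex>)\<close> are extended by zero to the real line.\<close>

definition test_functions :: "real set \<Rightarrow> (real \<Rightarrow> complex) set" where
  "test_functions I =
     {f. smooth f \<and> compact (closure {x. f x \<noteq> 0}) \<and> closure {x. f x \<noteq> 0} \<subseteq> I}"

abbreviation meas :: "real \<Rightarrow> real \<Rightarrow> real measure" where
  "meas a b \<equiv> lebesgue_on {a<..<b}"

definition D_op :: "real \<Rightarrow> real \<Rightarrow> real l2_op" where
  "D_op a b =
     {(ae_class (meas a b) f, ae_class (meas a b) (vderiv f)) | f. f \<in> test_functions {a<..<b}}"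

definition D_adj :: "real \<Rightarrow> real \<Rightarrow> real l2_op" where
  "D_adj a b = op_adjoint (meas a b) (D_op a b)"

definition W1 :: "real \<Rightarrow> real \<Rightarrow> (real \<Rightarrow> complex) set set" where
  "W1 a b = Domain (D_adj a b)"

definition W1_norm :: "real \<Rightarrow> real \<Rightarrow> (real \<Rightarrow> complex) set \<Rightarrow> real" where
  "W1_norm a b U =
     sqrt ((l2_norm (meas a b) U)\<^sup>2 + (l2_norm (meas a b) (op_apply (D_adj a b) U))\<^sup>2)"

definition W1_0 :: "real \<Rightarrow> real \<Rightarrow> (real \<Rightarrow> complex) set set" where
  "W1_0 a b =
     {U \<in> W1 a b. \<forall>\<epsilon>>0. \<exists>\<phi> \<in> test_functions {a<..<b}.
        W1_norm a b (l2_diff (meas a b) U (ae_class (meas a b) \<phi>)) < \<epsilon>}"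

definition Linf :: "'a measure \<Rightarrow> ('a \<Rightarrow> real) set" where
  "Linf M = {f \<in> borel_measurable M. \<exists>C. AE x in M. \<bar>f x\<bar> \<le> C}"

definition L1_norm :: "'a measure \<Rightarrow> ('a \<Rightarrow> real) \<Rightarrow> real" where
  "L1_norm M f = (LINT x|M. \<bar>f x\<bar>)"

definition coeffs_L :: "real \<Rightarrow> real \<Rightarrow> (real \<Rightarrow> real) set" where
  "coeffs_L a b =
     {p \<in> Linf (meas a b). \<exists>C1 C2. 0 < C1 \<and> C1 \<le> C2 \<and> (AE x in meas a b. C1 \<le> p x \<and> p x \<le> C2)}"

definition A_op :: "real \<Rightarrow> real \<Rightarrow> (real \<Rightarrow> real) \<Rightarrow> real l2_op" where
  "A_op a b p =
     {(U, V) \<in> op_uminus (meas a b) (D_adj a b O op_mult (meas a b) (\<lambda>x. 1 / p x) O D_adj a b).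
        U \<in> W1_0 a b}"

text \<open>
  \<open>neg_flux_op a b p\<close> is \<open>-(1/p) D\<^sup>* A\<inverse>\<close>, for the adjoint \<open>D\<^sup>*\<close> of \<^term>\<open>D_op a b\<close> and
  \<open>A\<close> = \<^term>\<open>A_op a b p\<close>.
\<close>

definition neg_flux_op :: "real \<Rightarrow> real \<Rightarrow> (real \<Rightarrow> real) \<Rightarrow> real l2_op" where
  "neg_flux_op a b p =
     op_uminus (meas a b) ((A_op a b p)\<inverse> O D_adj a b O op_mult (meas a b) (\<lambda>x. 1 / p x))"

definition B_fun :: "real \<Rightarrow> real \<Rightarrow> (real \<Rightarrow> real) \<Rightarrow> (real \<Rightarrow> complex) \<Rightarrow> real \<Rightarrow> complex" where
  "B_fun a b p f x =
     - (LINT y:{a<..<x}|lebesgue. complex_of_real (LINT u:{y<..<x}|lebesgue. p u) * f y)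
     + complex_of_real (inverse (L1_norm (meas a b) p) * (LINT y:{a<..<x}|lebesgue. p y))
       * (LINT y:{a<..<b}|lebesgue. complex_of_real (LINT x':{y<..<b}|lebesgue. p x') * f y)"

definition C_fun :: "real \<Rightarrow> real \<Rightarrow> (real \<Rightarrow> real) \<Rightarrow> (real \<Rightarrow> complex) \<Rightarrow> real \<Rightarrow> complex" where
  "C_fun a b p f x =
     - (LINT y:{a<..<x}|lebesgue. f y)
     + complex_of_real (inverse (L1_norm (meas a b) p))
       * (LINT y:{a<..<b}|lebesgue. complex_of_real (LINT x':{y<..<b}|lebesgue. p x') * f y)"

definition B_op :: "real \<Rightarrow> real \<Rightarrow> (real \<Rightarrow> real) \<Rightarrow> real l2_op" where
  "B_op a b p =
     {(ae_class (meas a b) f, ae_class (meas a b) (B_fun a b p f)) | f.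
        f \<in> sq_integrable (meas a b)}"

definition C_op :: "real \<Rightarrow> real \<Rightarrow> (real \<Rightarrow> real) \<Rightarrow> real l2_op" where
  "C_op a b p =
     {(ae_class (meas a b) f, ae_class (meas a b) (C_fun a b p f)) | f.
        f \<in> sq_integrable (meas a b)}"

end

theory Submission
  imports Defs
begin

text \<open>
  Write \<open>J f\<close> for the primitive \<open>x \<mapsto> \<integral>\<^sub>a\<^sup>x f\<close>. The equation \<open>-((1/p) u')' = f\<close> with zero boundary values
  can be solved by integrating twice. The first integration gives \<open>(1/p) u' = c - J f\<close> with a
  constant \<open>c\<close>, the second gives \<open>u = J (p (c - J f))\<close>, and \<open>u(b) = 0\<close> forces
  \<open>c = (\<integral> p \<cdot> J f) / \<integral> p\<close>. Exchanging the order of integration in \<open>\<integral> p \<cdot> J f\<close> turns these formulas into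
  the ones that define \<^const>\<open>B_fun\<close> and \<^const>\<open>C_fun\<close>. So \<open>A\<^sub>\<nu>\<inverse>\<close> and its flux operator are nothing but
  \<open>B\<close> and \<open>C\<close> with \<open>p\<^sub>\<nu>\<close> in place of \<open>p\<^sub>\<infinity>\<close> (\<open>A_op_inverse_eq\<close>, \<open>neg_flux_op_eq\<close>). The reciprocal of the
  coefficient has disappeared from the formulas, which is why the limit coefficient may vanish on
  a set of positive measure.

  The convergence is then a statement about two explicit families of integral operators.
  Since \<open>\<bar>J f\<bar> \<le> \<parallel>f\<parallel>\<^sub>1 \<le> (b - a)\<^sup>1\<^sup>/\<^sup>2 \<parallel>f\<parallel>\<^sub>2\<close> pointwise, changing the coefficient from \<open>q\<close> to \<open>p\<close> changes the flux by at
  most \<open>2 \<parallel>p - q\<parallel>\<^sub>1 / \<parallel>q\<parallel>\<^sub>1\<close> and the solution by at most \<open>4 \<parallel>p - q\<parallel>\<^sub>1\<close> times that bound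
  (\<open>flux_diff_le\<close>, \<open>potential_diff_le\<close>), uniformly in \<open>x\<close>.

  What remains is to justify the two integrations for the abstractly defined operators. Fubini's
  theorem shows that \<open>J g + c\<close> has weak derivative \<open>g\<close>. Test functions are dense in \<open>L\<^sup>2\<close>, even
  with mean value zero when the limit has mean value zero. This yields the uniqueness of the weak
  derivative, the lemma of du Bois-Reymond (a function in \<open>W\<^sup>1\<close> is the primitive of its weak
  derivative up to a constant), and the description of \<open>W\<^sup>1\<^sub>0\<close> as the set of all \<open>J g\<close> with \<open>\<integral> g = 0\<close>
  (\<open>prim_in_W1_0\<close>, \<open>W1_0_imp_prim\<close>).
\<close>

section \<open>Square-integrable functions\<close>

abbreviation sqn :: "'a measure \<Rightarrow> ('a \<Rightarrow> complex) \<Rightarrow> real" where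
  "sqn M f \<equiv> (LINT x|M. (cmod (f x))\<^sup>2)"

text \<open>
  This weak form of the triangle inequality, with squares and a factor of two, is all that the
  approximation arguments need; it spares the triangle inequality of the \<open>L\<^sup>2\<close>-norm.
\<close>

lemma norm_add_sq_le: "(cmod (x + y))\<^sup>2 \<le> 2 * (cmod x)\<^sup>2 + 2 * (cmod y)\<^sup>2"
proof -
  have "(cmod (x + y))\<^sup>2 \<le> (cmod x + cmod y)\<^sup>2"
    by (intro power_mono norm_triangle_ineq) simp
  also have "\<dots> \<le> 2 * (cmod x)\<^sup>2 + 2 * (cmod y)\<^sup>2"
    using sum_squares_bound[of "cmod x" "cmod y"] by (simp add: power2_sum)
  finally show ?thesis .
qed

lemma sq_integrable_measurable [measurable_dest]: "f \<in> sq_integrable M \<Longrightarrow> f \<in> borel_measurable M"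
  and sq_integrable_integrable_sq: "f \<in> sq_integrable M \<Longrightarrow> integrable M (\<lambda>x. (cmod (f x))\<^sup>2)"
  by (auto simp: sq_integrable_def)

lemma sq_integrable_add:
  assumes "f \<in> sq_integrable M" "g \<in> sq_integrable M"
  shows "(\<lambda>x. f x + g x) \<in> sq_integrable M"
proof -
  note [measurable] = assms[THEN sq_integrable_measurable]
  have "integrable M (\<lambda>x. (cmod (f x + g x))\<^sup>2)"
  proof (rule Bochner_Integration.integrable_bound)
    show "integrable M (\<lambda>x. 2 * (cmod (f x))\<^sup>2 + 2 * (cmod (g x))\<^sup>2)"
      using assms[THEN sq_integrable_integrable_sq] by simp
  qed (auto intro!: AE_I2 norm_add_sq_le)
  then show ?thesis
    by (simp add: sq_integrable_def)
qed

lemma sq_integrable_scale: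
  "f \<in> sq_integrable M \<Longrightarrow> (\<lambda>x. c * f x) \<in> sq_integrable M"
  by (auto simp: sq_integrable_def norm_mult power_mult_distrib)

lemma sq_integrable_minus: "f \<in> sq_integrable M \<Longrightarrow> (\<lambda>x. - f x) \<in> sq_integrable M"
  by (auto simp: sq_integrable_def)

lemma sq_integrable_diff:
  "f \<in> sq_integrable M \<Longrightarrow> g \<in> sq_integrable M \<Longrightarrow> (\<lambda>x. f x - g x) \<in> sq_integrable M"
  using sq_integrable_add[of f M "\<lambda>x. - g x"] sq_integrable_minus[of g M] by simp

lemma sq_integrable_zero: "(\<lambda>x. 0) \<in> sq_integrable M"
  by (simp add: sq_integrable_def)

lemma sq_integrable_cong_AE:
  assumes "f \<in> sq_integrable M" "g \<in> borel_measurable M" "AE x in M. g x = f x"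
  shows "g \<in> sq_integrable M"
proof -
  have "integrable M (\<lambda>x. (cmod (g x))\<^sup>2) \<longleftrightarrow> integrable M (\<lambda>x. (cmod (f x))\<^sup>2)"
    by (rule integrable_cong_AE)
       (use assms in \<open>auto dest: sq_integrable_measurable elim: eventually_mono\<close>)
  with assms show ?thesis by (simp add: sq_integrable_def)
qed

lemma sq_integrable_bounded:
  assumes "finite_measure M" "f \<in> borel_measurable M" "AE x in M. cmod (f x) \<le> K"
  shows "f \<in> sq_integrable M"
proof -
  interpret finite_measure M by fact
  have "integrable M (\<lambda>x. (cmod (f x))\<^sup>2)"
    by (rule integrable_const_bound[where B="K\<^sup>2"])
       (use assms in \<open>auto elim!: eventually_mono intro: power_mono\<close>)
  with assms show ?thesis by (simp add: sq_integrable_def)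
qed

lemma sq_integrable_bounded_mult:
  assumes "f \<in> sq_integrable M" "g \<in> borel_measurable M" "AE x in M. cmod (g x) \<le> K"
  shows "(\<lambda>x. g x * f x) \<in> sq_integrable M"
proof -
  note [measurable] = assms(2) assms(1)[THEN sq_integrable_measurable]
  have "integrable M (\<lambda>x. (cmod (g x * f x))\<^sup>2)"
  proof (rule Bochner_Integration.integrable_bound)
    show "integrable M (\<lambda>x. K\<^sup>2 * (cmod (f x))\<^sup>2)"
      using assms(1)[THEN sq_integrable_integrable_sq] by simp
    show "AE x in M. norm ((cmod (g x * f x))\<^sup>2) \<le> norm (K\<^sup>2 * (cmod (f x))\<^sup>2)"
      using assms(3)
      by eventually_elim (auto simp: norm_mult power_mult_distrib intro!: mult_right_mono power_mono)
  qed measurable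
  then show ?thesis by (simp add: sq_integrable_def)
qed

lemma integrable_sq_mult:
  assumes "f \<in> sq_integrable M" "g \<in> sq_integrable M"
  shows "integrable M (\<lambda>x. f x * g x)"
proof (rule Bochner_Integration.integrable_bound)
  show "integrable M (\<lambda>x. (cmod (f x))\<^sup>2 + (cmod (g x))\<^sup>2)"
    using assms[THEN sq_integrable_integrable_sq] by simp
  have "cmod (x * y) \<le> (cmod x)\<^sup>2 + (cmod y)\<^sup>2" for x y
    using sum_squares_bound[of "cmod x" "cmod y"] 
      mult_nonneg_nonneg[OF norm_ge_zero[of x] norm_ge_zero[of y]]
    unfolding norm_mult by linarith
  then show "AE x in M. norm (f x * g x) \<le> norm ((cmod (f x))\<^sup>2 + (cmod (g x))\<^sup>2)"
    by simp
qed (use assms[THEN sq_integrable_measurable] in measurable)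

lemma borel_measurable_cnj [measurable (raw)]:
  "f \<in> borel_measurable M \<Longrightarrow> (\<lambda>x. cnj (f x)) \<in> borel_measurable M"
  using measurable_compose[OF _ borel_measurable_continuous_onI[OF continuous_on_cnj[OF continuous_on_id]], of f M]
  by simp

lemma sq_integrable_cnj: "f \<in> sq_integrable M \<Longrightarrow> (\<lambda>x. cnj (f x)) \<in> sq_integrable M"
  by (auto simp: sq_integrable_def)

lemma integrable_sq_mult_cnj:
  "f \<in> sq_integrable M \<Longrightarrow> g \<in> sq_integrable M \<Longrightarrow> integrable M (\<lambda>x. cnj (f x) * g x)"
  using integrable_sq_mult[OF sq_integrable_cnj] .

lemma sqn_nonneg [simp]: "0 \<le> sqn M f"
  by simp

lemma sqn_add_le:
  assumes "f \<in> sq_integrable M" "g \<in> sq_integrable M"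
  shows "sqn M (\<lambda>x. f x + g x) \<le> 2 * sqn M f + 2 * sqn M g"
proof -
  have "sqn M (\<lambda>x. f x + g x) \<le> (LINT x|M. 2 * (cmod (f x))\<^sup>2 + 2 * (cmod (g x))\<^sup>2)"
    by (intro integral_mono sq_integrable_integrable_sq sq_integrable_add
        Bochner_Integration.integrable_add integrable_mult_right assms norm_add_sq_le)
  also have "\<dots> = 2 * sqn M f + 2 * sqn M g"
    using assms[THEN sq_integrable_integrable_sq] by simp
  finally show ?thesis .
qed

text \<open>
  The quadratic polynomial \<open>t \<mapsto> \<integral> (t \<bar>f\<bar> - \<bar>g\<bar>)\<^sup>2\<close> is nonnegative, which bounds its linear coefficient.
\<close>

lemma Cauchy_Schwarz_sqn:
  assumes f: "f \<in> sq_integrable M" and g: "g \<in> sq_integrable M"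
  shows "(LINT x|M. cmod (f x * g x)) \<le> sqrt (sqn M f) * sqrt (sqn M g)"
proof -
  let ?P = "LINT x|M. cmod (f x * g x)"
  have int: "integrable M (\<lambda>x. cmod (f x * g x))"
    using integrable_sq_mult[OF f g] by simp
  have key: "2 * t * ?P \<le> t\<^sup>2 * sqn M f + sqn M g" for t :: real
  proof -
    have "(LINT x|M. 2 * t * cmod (f x * g x)) \<le> (LINT x|M. t\<^sup>2 * (cmod (f x))\<^sup>2 + (cmod (g x))\<^sup>2)"
    proof (rule integral_mono)
      show "2 * t * cmod (f x * g x) \<le> t\<^sup>2 * (cmod (f x))\<^sup>2 + (cmod (g x))\<^sup>2" for x
        using sum_squares_bound[of "t * cmod (f x)" "cmod (g x)"]
        by (simp add: norm_mult power_mult_distrib algebra_simps)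
    qed (use int f g in \<open>auto intro!: sq_integrable_integrable_sq\<close>)
    then show ?thesis
      using f g by (simp add: sq_integrable_integrable_sq)
  qed
  have P: "?P \<ge> 0" by simp
  have "?P\<^sup>2 \<le> sqn M f * sqn M g"
  proof (cases "sqn M f = 0")
    case True
    have "?P = 0"
    proof (rule ccontr)
      assume "?P \<noteq> 0"
      with P have "?P > 0" by linarith
      then have "2 * ((sqn M g + 1) / ?P) * ?P = 2 * (sqn M g + 1)" by simp
      \<comment> \<open>Without a quadratic term the linear one must vanish; this \<open>t\<close> is large enough to see it.\<close>
      with key[of "(sqn M g + 1) / ?P"] True have "2 * (sqn M g + 1) \<le> sqn M g" by simp
      moreover have "s < 2 * (s + 1)" if "0 \<le> s" for s :: real using that by simp
      ultimately show False using sqn_nonneg[of M g] by (meson not_le)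
    qed
    then show ?thesis using True by simp
  next
    case False
    then have pos: "sqn M f > 0" by (simp add: order_less_le)
    \<comment> \<open>This is the \<open>t\<close> at which the quadratic polynomial is smallest.\<close>
    have "2 * (?P / sqn M f) * ?P \<le> (?P / sqn M f)\<^sup>2 * sqn M f + sqn M g"
      by (rule key)
    then show ?thesis using pos by (simp add: field_simps power2_eq_square)
  qed
  then have "sqrt (?P\<^sup>2) \<le> sqrt (sqn M f * sqn M g)" by (rule real_sqrt_le_mono)
  then show ?thesis using P by (simp add: real_sqrt_mult)
qed

lemma Cauchy_Schwarz_inner:
  assumes "f \<in> sq_integrable M" "g \<in> sq_integrable M"
  shows "cmod (LINT x|M. cnj (f x) * g x) \<le> sqrt (sqn M f) * sqrt (sqn M g)"
proof -
  have "cmod (LINT x|M. cnj (f x) * g x) \<le> (LINT x|M. cmod (f x * g x))"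
    using integral_norm_bound[of M "\<lambda>x. cnj (f x) * g x"] by (simp add: norm_mult)
  also note Cauchy_Schwarz_sqn[OF assms]
  finally show ?thesis .
qed

lemma integrable_of_sq:
  assumes "finite_measure M" "f \<in> sq_integrable M"
  shows "integrable M f"
proof -
  interpret finite_measure M by fact
  have "(\<lambda>x. 1) \<in> sq_integrable M" by (simp add: sq_integrable_def)
  from integrable_sq_mult[OF this assms(2)] show ?thesis by simp
qed

lemma L1_le_L2:
  assumes "finite_measure M" "f \<in> sq_integrable M"
  shows "(LINT x|M. cmod (f x)) \<le> sqrt (measure M (space M)) * sqrt (sqn M f)"
proof -
  interpret finite_measure M by fact
  have "(\<lambda>x. 1) \<in> sq_integrable M" by (simp add: sq_integrable_def)
  from Cauchy_Schwarz_sqn[OF this assms(2)] show ?thesis by simp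
qed

lemma sqn_le_of_bound:
  assumes "finite_measure M" "\<And>x. x \<in> space M \<Longrightarrow> cmod (f x) \<le> K" "0 \<le> K"
  shows "sqrt (sqn M f) \<le> sqrt (measure M (space M)) * K"
proof -
  interpret finite_measure M by fact
  have "sqn M f \<le> (LINT x|M. K\<^sup>2)"
  proof (cases "integrable M (\<lambda>x. (cmod (f x))\<^sup>2)")
    case True
    then show ?thesis
      by (intro integral_mono power_mono assms) auto
  qed (simp add: not_integrable_integral_eq)
  also have "\<dots> = measure M (space M) * K\<^sup>2" by simp
  finally have "sqrt (sqn M f) \<le> sqrt (measure M (space M) * K\<^sup>2)" by simp
  then show ?thesis using assms(3) by (simp add: real_sqrt_mult)
qed

section \<open>Classes of functions modulo null sets\<close>

lemma ae_class_cong: "AE x in M. f x = g x \<Longrightarrow> ae_class M f = ae_class M g"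
  unfolding ae_class_def by (auto elim!: eventually_rev_mp)

lemma ae_class_eq_iff:
  assumes "f \<in> borel_measurable M"
  shows "ae_class M f = ae_class M g \<longleftrightarrow> (AE x in M. f x = g x)"
proof
  assume "ae_class M f = ae_class M g"
  moreover have "f \<in> ae_class M f" using assms by (simp add: ae_class_def)
  ultimately show "AE x in M. f x = g x" by (simp add: ae_class_def)
qed (rule ae_class_cong)

text \<open>
  Together with the rules below, this removes the arbitrary representatives from all vector space
  operations, so that everything can be computed with functions.
\<close>

lemma rep_ae_class:
  assumes "f \<in> borel_measurable M"
  shows "rep (ae_class M f) \<in> borel_measurable M" "AE x in M. rep (ae_class M f) x = f x"
proof -
  have "f \<in> ae_class M f" using assms by (simp add: ae_class_def)
  then have "rep (ae_class M f) \<in> ae_class M f" unfolding rep_def by (rule someI[where P="\<lambda>h. h \<in> ae_class M f"])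
  then show "rep (ae_class M f) \<in> borel_measurable M" "AE x in M. rep (ae_class M f) x = f x"
    by (auto simp: ae_class_def)
qed

lemma ae_class_in_L2: "f \<in> sq_integrable M \<Longrightarrow> ae_class M f \<in> L2 M"
  by (auto simp: L2_def)

lemma L2_rep:
  assumes "X \<in> L2 M"
  shows "rep X \<in> sq_integrable M" "ae_class M (rep X) = X"
proof -
  from assms obtain f where f: "f \<in> sq_integrable M" and X: "X = ae_class M f"
    by (auto simp: L2_def)
  note r = rep_ae_class[OF sq_integrable_measurable[OF f]]
  show "rep X \<in> sq_integrable M" unfolding X by (rule sq_integrable_cong_AE[OF f r])
  show "ae_class M (rep X) = X" unfolding X by (rule ae_class_cong[OF r(2)])
qed

lemma l2_scale_ae_class:
  assumes "f \<in> borel_measurable M"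
  shows "l2_scale M c (ae_class M f) = ae_class M (\<lambda>x. c * f x)"
  unfolding l2_scale_def
  by (rule ae_class_cong) (use rep_ae_class(2)[OF assms] in \<open>auto elim: eventually_mono\<close>)

lemma l2_add_ae_class:
  assumes "f \<in> borel_measurable M" "g \<in> borel_measurable M"
  shows "l2_add M (ae_class M f) (ae_class M g) = ae_class M (\<lambda>x. f x + g x)"
  unfolding l2_add_def
  by (rule ae_class_cong)
     (use rep_ae_class(2)[OF assms(1)] rep_ae_class(2)[OF assms(2)] in \<open>auto elim: eventually_elim2\<close>)

lemma l2_diff_ae_class:
  assumes "f \<in> borel_measurable M" "g \<in> borel_measurable M"
  shows "l2_diff M (ae_class M f) (ae_class M g) = ae_class M (\<lambda>x. f x - g x)"
  using assms by (simp add: l2_diff_def l2_scale_ae_class l2_add_ae_class)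

lemma l2_norm_ae_class:
  assumes [measurable]: "f \<in> borel_measurable M"
  shows "l2_norm M (ae_class M f) = sqrt (sqn M f)"
proof -
  note [measurable] = rep_ae_class(1)[OF assms]
  have "sqn M (rep (ae_class M f)) = sqn M f"
    by (rule integral_cong_AE) (use rep_ae_class(2)[OF assms] in \<open>auto elim: eventually_mono\<close>)
  then show ?thesis by (simp add: l2_norm_def)
qed

lemma l2_inner_ae_class:
  assumes [measurable]: "f \<in> borel_measurable M" "g \<in> borel_measurable M"
  shows "l2_inner M (ae_class M f) (ae_class M g) = (LINT x|M. cnj (f x) * g x)"
proof -
  note [measurable] = rep_ae_class(1)[OF assms(1)] rep_ae_class(1)[OF assms(2)]
  show ?thesis
    unfolding l2_inner_def
    by (rule integral_cong_AE)
      (use rep_ae_class(2)[OF assms(1)] rep_ae_class(2)[OF assms(2)] in \<open>auto elim: eventually_elim2\<close>)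
qed

section \<open>Operators induced by maps of functions\<close>

definition induced_op ::
    "'a measure \<Rightarrow> (('a \<Rightarrow> complex) \<Rightarrow> 'a \<Rightarrow> complex) \<Rightarrow> 'a l2_op" where
  "induced_op M t = {(ae_class M f, ae_class M (t f)) | f. f \<in> sq_integrable M}"

text \<open>
  The conditions under which a map of functions passes to a bounded linear operator on classes.
  Linearity is required only almost everywhere because equality of classes is.
\<close>

definition l2_bounded_map ::
    "'a measure \<Rightarrow> real \<Rightarrow> (('a \<Rightarrow> complex) \<Rightarrow> 'a \<Rightarrow> complex) \<Rightarrow> bool" where
  "l2_bounded_map M K t \<longleftrightarrow>
     (\<forall>f \<in> sq_integrable M. t f \<in> sq_integrable M \<and> sqrt (sqn M (t f)) \<le> K * sqrt (sqn M f) \<and>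
        (\<forall>g \<in> sq_integrable M. (AE x in M. f x = g x) \<longrightarrow> (AE x in M. t f x = t g x)) \<and>
        (\<forall>g \<in> sq_integrable M. AE x in M. t (\<lambda>y. f y + g y) x = t f x + t g x) \<and>
        (\<forall>c. AE x in M. t (\<lambda>y. c * f y) x = c * t f x))"

lemma induced_op_bounded:
  assumes "l2_bounded_map M K t"
  shows "induced_op M t \<in> bounded_ops M"
proof -
  have t: "t f \<in> sq_integrable M" "sqrt (sqn M (t f)) \<le> K * sqrt (sqn M f)"
    "g \<in> sq_integrable M \<Longrightarrow> AE x in M. f x = g x \<Longrightarrow> AE x in M. t f x = t g x"
    "g \<in> sq_integrable M \<Longrightarrow> AE x in M. t (\<lambda>y. f y + g y) x = t f x + t g x"
    "AE x in M. t (\<lambda>y. c * f y) x = c * t f x" if "f \<in> sq_integrable M" for f g c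
    using assms that by (auto simp: l2_bounded_map_def)
  note m = sq_integrable_measurable
  have "induced_op M t \<subseteq> L2 M \<times> L2 M"
    by (auto simp: induced_op_def intro!: ae_class_in_L2 t)
  moreover have "Domain (induced_op M t) = L2 M"
    by (auto simp: induced_op_def L2_def)
  moreover have "single_valued (induced_op M t)"
    by (rule single_valuedI)
       (auto simp: induced_op_def ae_class_eq_iff m intro!: ae_class_cong t)
  moreover have "linear_op M (induced_op M t)"
    unfolding linear_op_def
  proof (intro conjI ballI allI; clarify)
    fix X Y X' Y' assume "(X, Y) \<in> induced_op M t" "(X', Y') \<in> induced_op M t"
    then obtain f g where f: "f \<in> sq_integrable M" "X = ae_class M f" "Y = ae_class M (t f)"
      and g: "g \<in> sq_integrable M" "X' = ae_class M g" "Y' = ae_class M (t g)"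
      by (auto simp: induced_op_def)
    have "ae_class M (\<lambda>x. t f x + t g x) = ae_class M (t (\<lambda>x. f x + g x))"
      by (rule ae_class_cong) (use t(4)[OF f(1) g(1)] in \<open>auto elim: eventually_mono\<close>)
    then show "(l2_add M X X', l2_add M Y Y') \<in> induced_op M t"
      using f g unfolding induced_op_def
      by (auto simp: l2_add_ae_class m t intro!: exI[of _ "\<lambda>x. f x + g x"] sq_integrable_add)
  next
    fix c X Y assume "(X, Y) \<in> induced_op M t"
    then obtain f where f: "f \<in> sq_integrable M" "X = ae_class M f" "Y = ae_class M (t f)"
      by (auto simp: induced_op_def)
    have "ae_class M (\<lambda>x. c * t f x) = ae_class M (t (\<lambda>x. c * f x))"
      by (rule ae_class_cong) (use t(5)[OF f(1), of c] in \<open>auto elim: eventually_mono\<close>)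
    then show "(l2_scale M c X, l2_scale M c Y) \<in> induced_op M t"
      using f unfolding induced_op_def
      by (auto simp: l2_scale_ae_class m t intro!: exI[of _ "\<lambda>x. c * f x"] sq_integrable_scale)
  qed
  moreover have "\<forall>(X, Y) \<in> induced_op M t. l2_norm M Y \<le> K * l2_norm M X"
    by (auto simp: induced_op_def l2_norm_ae_class m t)
  ultimately show ?thesis
    unfolding bounded_ops_def by blast
qed

lemma op_norm_diff_induced_le:
  assumes t: "l2_bounded_map M K t" and s: "l2_bounded_map M K' s"
    and le: "\<And>f. f \<in> sq_integrable M \<Longrightarrow>
      sqrt (sqn M (\<lambda>x. t f x - s f x)) \<le> \<delta> * sqrt (sqn M f)"
    and "0 \<le> \<delta>"
  shows "0 \<le> op_norm M (op_diff M (induced_op M t) (induced_op M s))"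
    and "op_norm M (op_diff M (induced_op M t) (induced_op M s)) \<le> \<delta>"
proof -
  note m = sq_integrable_measurable
  have tm: "t f \<in> sq_integrable M" and sm: "s f \<in> sq_integrable M"
    if "f \<in> sq_integrable M" for f
    using t s that by (auto simp: l2_bounded_map_def)
  let ?D = "op_diff M (induced_op M t) (induced_op M s)"
  let ?S = "{l2_norm M Y | X Y. (X, Y) \<in> ?D \<and> l2_norm M X \<le> 1}"
  have D: "\<exists>f \<in> sq_integrable M. X = ae_class M f \<and> Y = ae_class M (\<lambda>x. t f x - s f x)"
    if "(X, Y) \<in> ?D" for X Y
  proof -
    from that obtain f g where f: "f \<in> sq_integrable M" "X = ae_class M f"
      and g: "g \<in> sq_integrable M" "X = ae_class M g"
      and Y: "Y = l2_diff M (ae_class M (t f)) (ae_class M (s g))"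
      by (auto simp: op_diff_def induced_op_def)
    \<comment> \<open>The two operators may see different representatives of the same class.\<close>
    have "AE x in M. f x = g x"
      using f(2) g(2) by (simp add: ae_class_eq_iff[OF m[OF f(1)], symmetric])
    with s f g have "AE x in M. s f x = s g x"
      by (auto simp: l2_bounded_map_def)
    then have "ae_class M (s f) = ae_class M (s g)" by (rule ae_class_cong)
    then have "Y = l2_diff M (ae_class M (t f)) (ae_class M (s f))" using Y by simp
    then show ?thesis using f
      by (intro bexI[of _ f]) (auto simp: l2_diff_ae_class m tm sm)
  qed
  have ub: "y \<le> \<delta>" if "y \<in> ?S" for y
  proof -
    from that D obtain f where f: "f \<in> sq_integrable M"
      and y: "y = l2_norm M (ae_class M (\<lambda>x. t f x - s f x))" and X: "l2_norm M (ae_class M f) \<le> 1"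
      by blast
    have "y = sqrt (sqn M (\<lambda>x. t f x - s f x))"
      unfolding y by (rule l2_norm_ae_class) (intro m sq_integrable_diff tm sm f)
    also have "\<dots> \<le> \<delta> * sqrt (sqn M f)" by (rule le[OF f])
    also have "\<dots> \<le> \<delta> * 1"
      using X f \<open>0 \<le> \<delta>\<close> by (intro mult_left_mono) (simp_all add: l2_norm_ae_class m)
    finally show ?thesis by simp
  qed
  \<comment> \<open>The supremum of an empty set is unspecified, so the set of norms needs a member.\<close>
  have z: "(\<lambda>x. 0) \<in> sq_integrable M" by (rule sq_integrable_zero)
  have "(ae_class M (\<lambda>x. 0), l2_diff M (ae_class M (t (\<lambda>x. 0))) (ae_class M (s (\<lambda>x. 0)))) \<in> ?D"
    using z by (auto simp: op_diff_def induced_op_def)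
  moreover have "l2_norm M (ae_class M (\<lambda>x. 0)) \<le> 1" by (simp add: l2_norm_ae_class)
  ultimately have mem: "l2_norm M (l2_diff M (ae_class M (t (\<lambda>x. 0))) (ae_class M (s (\<lambda>x. 0)))) \<in> ?S"
    by blast
  then have ne: "?S \<noteq> {}" by blast
  show "op_norm M ?D \<le> \<delta>"
    unfolding op_norm_def by (rule cSup_least[OF ne ub])
  have "0 \<le> l2_norm M (l2_diff M (ae_class M (t (\<lambda>x. 0))) (ae_class M (s (\<lambda>x. 0))))"
    by (simp add: l2_norm_def)
  also have "\<dots> \<le> op_norm M ?D"
    unfolding op_norm_def by (rule cSup_upper[OF mem]) (use ub in \<open>auto simp: bdd_above_def\<close>)
  finally show "0 \<le> op_norm M ?D" .
qed

section \<open>Primitives and the explicit solution\<close>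

lemma finite_meas: "finite_measure (meas a b)"
  by (rule finite_measure_lebesgue_on) simp

lemma measure_meas: "a < b \<Longrightarrow> measure (meas a b) {a<..<b} = b - a"
  by (simp add: measure_restrict_space)

definition prim :: "real \<Rightarrow> real \<Rightarrow> (real \<Rightarrow> complex) \<Rightarrow> real \<Rightarrow> complex" where
  "prim a b f x = (LINT y|meas a b. (if y < x then f y else 0))"

text \<open>
  The transpose of \<^const>\<open>prim\<close>, see \<open>tail_prim_swap\<close> below.
\<close>

definition tail :: "real \<Rightarrow> real \<Rightarrow> (real \<Rightarrow> complex) \<Rightarrow> real \<Rightarrow> complex" where
  "tail a b p y = (LINT x|meas a b. (if y < x then p x else 0))"

lemma meas_borel_id [measurable]: "(\<lambda>x. x) \<in> borel_measurable (meas a b)"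
  using id_borel_measurable_lebesgue_on[of "{a<..<b}"] by (simp add: id_def)

lemma continuous_measurable_meas:
  fixes f :: "real \<Rightarrow> 'c::topological_space"
  assumes "continuous_on UNIV f"
  shows "f \<in> borel_measurable (meas a b)"
  using measurable_compose[OF meas_borel_id borel_measurable_continuous_onI[OF assms]] .

lemma integrable_restrict_less:
  fixes f :: "real \<Rightarrow> complex"
  assumes "integrable (meas a b) f"
  shows "integrable (meas a b) (\<lambda>y. if y < x then f y else 0)"
    "integrable (meas a b) (\<lambda>y. if x < y then f y else 0)"
proof -
  note [measurable] = borel_measurable_integrable[OF assms]
  show "integrable (meas a b) (\<lambda>y. if y < x then f y else 0)"
    by (rule Bochner_Integration.integrable_bound[OF assms]) auto
  show "integrable (meas a b) (\<lambda>y. if x < y then f y else 0)"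
    by (rule Bochner_Integration.integrable_bound[OF assms]) auto
qed

lemma prim_measurable:
  assumes [measurable]: "f \<in> borel_measurable (meas a b)"
  shows "prim a b f \<in> borel_measurable (meas a b)"
proof -
  interpret finite_measure "meas a b" by (rule finite_meas)
  show ?thesis unfolding prim_def by measurable
qed

lemma prim_bound:
  assumes "integrable (meas a b) f"
  shows "cmod (prim a b f x) \<le> (LINT y|meas a b. cmod (f y))"
proof -
  have "cmod (prim a b f x) \<le> (LINT y|meas a b. cmod (if y < x then f y else 0))"
    unfolding prim_def by (rule integral_norm_bound)
  also have "\<dots> \<le> (LINT y|meas a b. cmod (f y))"
    by (rule integral_mono) (use assms integrable_restrict_less[OF assms] in auto)
  finally show ?thesis .
qed

lemma prim_bounded_mult:
  assumes p: "integrable (meas a b) p" and f: "integrable (meas a b) f"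
  shows "integrable (meas a b) (\<lambda>x. p x * prim a b f x)"
proof (rule Bochner_Integration.integrable_bound)
  let ?K = "LINT y|meas a b. cmod (f y)"
  show "integrable (meas a b) (\<lambda>x. ?K * p x)"
    using p by simp
  show "AE x in meas a b. cmod (p x * prim a b f x) \<le> cmod (?K * p x)"
    using prim_bound[OF f] by (auto simp: norm_mult mult.commute intro!: mult_left_mono)
qed (intro borel_measurable_times borel_measurable_integrable prim_measurable p f)

lemma sqn_prim_le:
  assumes "a < b" "g \<in> sq_integrable (meas a b)"
  shows "sqrt (sqn (meas a b) (prim a b g)) \<le> (b - a) * sqrt (sqn (meas a b) g)"
proof -
  have K: "cmod (prim a b g x) \<le> sqrt (b - a) * sqrt (sqn (meas a b) g)" for x
    using prim_bound[OF integrable_of_sq[OF finite_meas assms(2)], of x]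
      L1_le_L2[OF finite_meas assms(2)] assms(1) by (simp add: measure_meas)
  have "sqrt (sqn (meas a b) (prim a b g)) \<le> sqrt (b - a) * (sqrt (b - a) * sqrt (sqn (meas a b) g))"
    using sqn_le_of_bound[OF finite_meas[of a b] K] assms(1) by (simp add: measure_meas)
  then show ?thesis using assms(1) by (simp add: mult.assoc[symmetric])
qed

lemma prim_sq_integrable:
  assumes "g \<in> borel_measurable (meas a b)" "integrable (meas a b) g"
  shows "prim a b g \<in> sq_integrable (meas a b)"
  using sq_integrable_bounded[OF finite_meas prim_measurable[OF assms(1)], of "LINT y|meas a b. cmod (g y)"]
    prim_bound[OF assms(2)] by auto

lemma prim_add:
  assumes "integrable (meas a b) f" "integrable (meas a b) g"
  shows "prim a b (\<lambda>y. f y + g y) x = prim a b f x + prim a b g x"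
proof -
  have "prim a b (\<lambda>y. f y + g y) x =
      (LINT y|meas a b. (if y < x then f y else 0) + (if y < x then g y else 0))"
    unfolding prim_def by (rule Bochner_Integration.integral_cong) auto
  then show ?thesis
    unfolding prim_def using integrable_restrict_less[OF assms(1)] integrable_restrict_less[OF assms(2)]
    by simp
qed

lemma prim_scale: "prim a b (\<lambda>y. c * f y) x = c * prim a b f x"
proof -
  have "prim a b (\<lambda>y. c * f y) x = (LINT y|meas a b. c * (if y < x then f y else 0))"
    unfolding prim_def by (rule Bochner_Integration.integral_cong) auto
  then show ?thesis unfolding prim_def by simp
qed

lemma prim_diff:
  assumes "integrable (meas a b) f" "integrable (meas a b) g"
  shows "prim a b (\<lambda>y. f y - g y) x = prim a b f x - prim a b g x"
  using prim_add[OF assms(1), of "\<lambda>y. -1 * g y" x] assms(2) prim_scale[of a b "-1" g x] by simp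

lemma prim_cong_AE:
  assumes [measurable]: "f \<in> borel_measurable (meas a b)" "g \<in> borel_measurable (meas a b)"
    and "AE x in meas a b. f x = g x"
  shows "prim a b f = prim a b g"
  unfolding prim_def
  by (rule ext, rule integral_cong_AE) (use assms(3) in \<open>auto elim: eventually_mono\<close>)

text \<open>
  Both sides integrate \<open>p(x) f(y)\<close> over the triangle \<open>y < x\<close>. This one exchange of integrals serves
  twice: it brings \<^const>\<open>B_fun\<close> and \<^const>\<open>C_fun\<close> into the form of iterated primitives, and, with a
  derivative of a test function as \<open>p\<close>, it is integration by parts.
\<close>

lemma tail_prim_swap:
  assumes p: "integrable (meas a b) p" and f: "integrable (meas a b) f"
  shows "(LINT y|meas a b. tail a b p y * f y) = (LINT x|meas a b. p x * prim a b f x)"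
proof -
  interpret M: finite_measure "meas a b" by (rule finite_meas)
  interpret P: pair_sigma_finite "meas a b" "meas a b" ..
  note [measurable] = borel_measurable_integrable[OF p] borel_measurable_integrable[OF f]
  have prod: "integrable (meas a b \<Otimes>\<^sub>M meas a b) (\<lambda>(x, y). p x * f y)"
  proof (rule P.Fubini_integrable)
    have "(\<lambda>x. LINT y|meas a b. norm (case (x, y) of (x, y) \<Rightarrow> p x * f y))
      = (\<lambda>x. cmod (p x) * (LINT y|meas a b. cmod (f y)))"
      by (simp add: norm_mult)
    then show "integrable (meas a b) (\<lambda>x. LINT y|meas a b. norm (case (x, y) of (x, y) \<Rightarrow> p x * f y))"
      using p by simp
  qed (use f in auto)
  have int: "integrable (meas a b \<Otimes>\<^sub>M meas a b) (\<lambda>(x, y). if y < x then p x * f y else 0)"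
    by (rule Bochner_Integration.integrable_bound[OF prod]) (auto simp: case_prod_beta)
  have "(LINT y|meas a b. tail a b p y * f y)
      = (LINT y|meas a b. LINT x|meas a b. (if y < x then p x * f y else 0))"
    unfolding tail_def
    by (simp add: if_distrib[of "\<lambda>z. z * _"] cong: if_cong flip: integral_mult_left_zero)
  also have "\<dots> = (LINT x|meas a b. LINT y|meas a b. (if y < x then p x * f y else 0))"
    by (rule P.Fubini_integral[OF int])
  also have "\<dots> = (LINT x|meas a b. p x * prim a b f x)"
    unfolding prim_def
    by (simp add: if_distrib[of "\<lambda>z. _ * z"] cong: if_cong flip: integral_mult_right_zero)
  finally show ?thesis .
qed

text \<open>
  The constant of the first integration: it is the one that makes the integral of
  \<open>p (c - J f)\<close>, and hence the boundary value of the solution at \<open>b\<close>, zero when \<open>p \<ge> 0\<close>.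
\<close>

definition flux_const :: "real \<Rightarrow> real \<Rightarrow> (real \<Rightarrow> real) \<Rightarrow> (real \<Rightarrow> complex) \<Rightarrow> complex" where
  "flux_const a b p f =
     (LINT x|meas a b. of_real (p x) * prim a b f x) / of_real (L1_norm (meas a b) p)"

text \<open>
  \<open>(1/p) u'\<close> for the solution \<open>u\<close> of \<open>-((1/p) u')' = f\<close>.
\<close>

definition flux :: "real \<Rightarrow> real \<Rightarrow> (real \<Rightarrow> real) \<Rightarrow> (real \<Rightarrow> complex) \<Rightarrow> real \<Rightarrow> complex" where
  "flux a b p f x = flux_const a b p f - prim a b f x"

text \<open>
  The solution \<open>u\<close> itself, obtained by integrating \<open>u' = p \<cdot> flux\<close> from the left end point, where \<open>u\<close>
  vanishes.
\<close>

definition potential :: "real \<Rightarrow> real \<Rightarrow> (real \<Rightarrow> real) \<Rightarrow> (real \<Rightarrow> complex) \<Rightarrow> real \<Rightarrow> complex" where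
  "potential a b p f = prim a b (\<lambda>y. of_real (p y) * flux a b p f y)"

lemma set_integral_eq_meas:
  fixes f :: "real \<Rightarrow> 'c::{banach, second_countable_topology}"
  assumes "{y<..<x} \<subseteq> {a<..<b}"
  shows "(LINT u:{y<..<x}|lebesgue. f u) = (LINT u|meas a b. (if y < u \<and> u < x then f u else 0))"
proof -
  have "(LINT u|meas a b. (if y < u \<and> u < x then f u else 0))
      = (LINT u:{a<..<b}|lebesgue. (if y < u \<and> u < x then f u else 0))"
    by (simp add: integral_restrict_space set_lebesgue_integral_def)
  also have "\<dots> = (LINT u:{y<..<x}|lebesgue. f u)"
    unfolding set_lebesgue_integral_def using assms
    by (intro Bochner_Integration.integral_cong) (auto simp: indicator_def subset_iff)
  finally show ?thesis by simp
qed

lemma tail_eq: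
  fixes p :: "real \<Rightarrow> real"
  assumes "y \<in> {a<..<b}" "x \<le> b"
  shows "complex_of_real (LINT u:{y<..<x}|lebesgue. p u)
    = tail a b (\<lambda>u. if u < x then of_real (p u) else 0) y"
proof -
  have "{y<..<x} \<subseteq> {a<..<b}" using assms by auto
  then have "complex_of_real (LINT u:{y<..<x}|lebesgue. p u)
    = of_real (LINT u|meas a b. (if y < u \<and> u < x then p u else 0))"
    by (simp only: set_integral_eq_meas)
  also have "\<dots> = (LINT u|meas a b. of_real (if y < u \<and> u < x then p u else 0))"
    by (rule integral_complex_of_real[symmetric])
  also have "\<dots> = tail a b (\<lambda>u. if u < x then of_real (p u) else 0) y"
    unfolding tail_def by (rule Bochner_Integration.integral_cong) auto
  finally show ?thesis .
qed

text \<open>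
  The double integrals in \<^const>\<open>B_fun\<close> and \<^const>\<open>C_fun\<close> are exchanged triangle integrals, with \<open>p\<close> cut
  off at \<open>x\<close>.
\<close>

lemma tail_integral_eq:
  assumes p: "integrable (meas a b) p" and f: "integrable (meas a b) f" and x: "a < x" "x \<le> b"
  shows "(LINT y:{a<..<x}|lebesgue. complex_of_real (LINT u:{y<..<x}|lebesgue. p u) * f y)
    = prim a b (\<lambda>y. of_real (p y) * prim a b f y) x"
proof -
  let ?q = "\<lambda>u. if u < x then complex_of_real (p u) else 0"
  have q: "integrable (meas a b) ?q"
    using integrable_restrict_less(1)[of a b "\<lambda>u. complex_of_real (p u)"] p by simp
  have tz: "tail a b ?q y = 0" if "x \<le> y" for y
  proof -
    have "tail a b ?q y = (LINT u|meas a b. 0)"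
      unfolding tail_def by (rule Bochner_Integration.integral_cong) (use that in auto)
    then show ?thesis by simp
  qed
  have "(LINT y:{a<..<x}|lebesgue. complex_of_real (LINT u:{y<..<x}|lebesgue. p u) * f y)
    = (LINT y|meas a b. (if a < y \<and> y < x then complex_of_real (LINT u:{y<..<x}|lebesgue. p u) * f y else 0))"
    using x by (intro set_integral_eq_meas) auto
  also have "\<dots> = (LINT y|meas a b. tail a b ?q y * f y)"
    by (rule Bochner_Integration.integral_cong) (use x in \<open>auto simp: tail_eq tz\<close>)
  also have "\<dots> = (LINT y|meas a b. ?q y * prim a b f y)"
    by (rule tail_prim_swap[OF q f])
  also have "\<dots> = prim a b (\<lambda>y. of_real (p y) * prim a b f y) x"
    unfolding prim_def[of a b "\<lambda>y. of_real (p y) * prim a b f y"]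
    by (rule Bochner_Integration.integral_cong) auto
  finally show ?thesis .
qed

lemma prim_eq_set_integral:
  assumes "a < x" "x \<le> b"
  shows "(LINT y:{a<..<x}|lebesgue. f y) = prim a b f x"
proof -
  have "(LINT y:{a<..<x}|lebesgue. f y) = (LINT y|meas a b. (if a < y \<and> y < x then f y else 0))"
    using assms by (intro set_integral_eq_meas) auto
  also have "\<dots> = prim a b f x"
    unfolding prim_def by (rule Bochner_Integration.integral_cong) auto
  finally show ?thesis .
qed

lemma prim_of_real:
  assumes "a < x" "x \<le> b"
  shows "complex_of_real (LINT y:{a<..<x}|lebesgue. p y) = prim a b (\<lambda>y. of_real (p y)) x"
proof -
  have "complex_of_real (LINT y:{a<..<x}|lebesgue. p y)
      = of_real (LINT y|meas a b. (if a < y \<and> y < x then p y else 0))"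
    using assms by (subst set_integral_eq_meas) auto
  also have "\<dots> = (LINT y|meas a b. of_real (if a < y \<and> y < x then p y else 0))"
    by (rule integral_complex_of_real[symmetric])
  also have "\<dots> = prim a b (\<lambda>y. of_real (p y)) x"
    unfolding prim_def by (rule Bochner_Integration.integral_cong) auto
  finally show ?thesis .
qed

lemma prim_end: "prim a b f b = (LINT y|meas a b. f y)"
  unfolding prim_def by (rule Bochner_Integration.integral_cong) auto

lemma C_fun_eq_flux:
  assumes p: "integrable (meas a b) p" and f: "integrable (meas a b) f" and x: "x \<in> {a<..<b}"
  shows "C_fun a b p f x = flux a b p f x"
proof -
  have ab: "a < b" and ax: "a < x" "x \<le> b" using x by auto
  show ?thesis
    unfolding C_fun_def flux_def flux_const_def prim_eq_set_integral[OF ax]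
      tail_integral_eq[OF p f ab order_refl] prim_end
    by (simp add: divide_inverse mult.commute)
qed

lemma integrable_mult_flux:
  assumes p: "integrable (meas a b) p" and f: "integrable (meas a b) f"
  shows "integrable (meas a b) (\<lambda>y. of_real (p y) * flux a b p' f y)"
proof -
  have pc: "integrable (meas a b) (\<lambda>y. complex_of_real (p y))" using p by simp
  show ?thesis
    unfolding flux_def right_diff_distrib
    by (intro Bochner_Integration.integrable_diff prim_bounded_mult pc f integrable_mult_left)
qed

lemma B_fun_eq_potential:
  assumes p: "integrable (meas a b) p" and f: "integrable (meas a b) f" and x: "x \<in> {a<..<b}"
  shows "B_fun a b p f x = potential a b p f x"
proof -
  have ab: "a < b" and ax: "a < x" "x \<le> b" using x by auto
  have pc: "integrable (meas a b) (\<lambda>y. complex_of_real (p y))" using p by simp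
  have "potential a b p f x = prim a b (\<lambda>y. flux_const a b p f * of_real (p y) - of_real (p y) * prim a b f y) x"
    unfolding potential_def flux_def by (simp add: algebra_simps)
  also have "\<dots> = prim a b (\<lambda>y. flux_const a b p f * of_real (p y)) x
      - prim a b (\<lambda>y. of_real (p y) * prim a b f y) x"
    by (intro prim_diff integrable_mult_right pc prim_bounded_mult f)
  also have "\<dots> = flux_const a b p f * prim a b (\<lambda>y. of_real (p y)) x
      - prim a b (\<lambda>y. of_real (p y) * prim a b f y) x"
    by (simp only: prim_scale)
  also have "\<dots> = B_fun a b p f x"
    unfolding B_fun_def of_real_mult flux_const_def prim_of_real[OF ax]
      tail_integral_eq[OF p f ax] tail_integral_eq[OF p f ab order_refl] prim_end
    by (simp add: divide_inverse mult_ac)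
  finally show ?thesis by simp
qed

section \<open>Dependence of the solution on the coefficient\<close>

lemma prim_le_sqn:
  assumes "a < b" "f \<in> sq_integrable (meas a b)"
  shows "cmod (prim a b f x) \<le> sqrt (b - a) * sqrt (sqn (meas a b) f)"
  using prim_bound[OF integrable_of_sq[OF finite_meas assms(2)], of x]
    L1_le_L2[OF finite_meas assms(2)] assms(1) by (simp add: measure_meas)

lemma integral_mult_prim_le:
  assumes "a < b" "f \<in> sq_integrable (meas a b)" "integrable (meas a b) q"
  shows "cmod (LINT x|meas a b. of_real (q x) * prim a b f x)
    \<le> L1_norm (meas a b) q * (sqrt (b - a) * sqrt (sqn (meas a b) f))"
proof -
  let ?K = "sqrt (b - a) * sqrt (sqn (meas a b) f)"
  have qc: "integrable (meas a b) (\<lambda>x. complex_of_real (q x))" using assms(3) by simp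
  have "cmod (LINT x|meas a b. of_real (q x) * prim a b f x)
      \<le> (LINT x|meas a b. cmod (of_real (q x) * prim a b f x))"
    by (rule integral_norm_bound)
  also have "\<dots> \<le> (LINT x|meas a b. \<bar>q x\<bar> * ?K)"
  proof (rule integral_mono)
    show "integrable (meas a b) (\<lambda>x. cmod (of_real (q x) * prim a b f x))"
      by (intro integrable_norm prim_bounded_mult qc integrable_of_sq finite_meas assms)
    show "integrable (meas a b) (\<lambda>x. \<bar>q x\<bar> * ?K)" using assms(3) by simp
    show "cmod (of_real (q x) * prim a b f x) \<le> \<bar>q x\<bar> * ?K" for x
      using prim_le_sqn[OF assms(1,2), of x] by (simp add: norm_mult mult_left_mono)
  qed
  also have "\<dots> = L1_norm (meas a b) q * ?K" by (simp add: L1_norm_def)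
  finally show ?thesis .
qed

lemma L1_norm_nonneg [simp]: "0 \<le> L1_norm M p"
  by (simp add: L1_norm_def)

lemma flux_const_le:
  assumes "a < b" "f \<in> sq_integrable (meas a b)" "integrable (meas a b) p"
  shows "cmod (flux_const a b p f) \<le> sqrt (b - a) * sqrt (sqn (meas a b) f)"
proof -
  let ?K = "sqrt (b - a) * sqrt (sqn (meas a b) f)"
  have K: "0 \<le> ?K" using assms(1) by simp
  show ?thesis
  proof (cases "L1_norm (meas a b) p = 0")
    case True
    then show ?thesis using K by (simp add: flux_const_def)
  next
    case False
    then have "L1_norm (meas a b) p > 0" by (simp add: order_less_le)
    then show ?thesis using integral_mult_prim_le[OF assms]
      by (simp add: flux_const_def norm_divide divide_le_eq mult.commute)
  qed
qed

lemma flux_le: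
  assumes "a < b" "f \<in> sq_integrable (meas a b)" "integrable (meas a b) p"
  shows "cmod (flux a b p f x) \<le> 2 * (sqrt (b - a) * sqrt (sqn (meas a b) f))"
  using norm_triangle_ineq4[of "flux_const a b p f" "prim a b f x"]
    flux_const_le[OF assms] prim_le_sqn[OF assms(1,2), of x]
  unfolding flux_def by linarith

text \<open>
  Fluxes for different coefficients differ only by their constants, which are the integrals of \<open>J f\<close>
  against \<open>p / \<parallel>p\<parallel>\<^sub>1\<close> and \<open>q / \<parallel>q\<parallel>\<^sub>1\<close>. The distance of the numerators and that of the
  denominators each contribute \<open>\<parallel>p - q\<parallel>\<^sub>1 / \<parallel>q\<parallel>\<^sub>1\<close>.
\<close>

lemma flux_diff_le:
  assumes "a < b" "f \<in> sq_integrable (meas a b)" "integrable (meas a b) p" "integrable (meas a b) q"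
    and q: "L1_norm (meas a b) q > 0" and p: "L1_norm (meas a b) p > 0"
  shows "cmod (flux a b p f x - flux a b q f x)
    \<le> 2 * L1_norm (meas a b) (\<lambda>x. p x - q x) / L1_norm (meas a b) q
      * (sqrt (b - a) * sqrt (sqn (meas a b) f))"
proof -
  let ?K = "sqrt (b - a) * sqrt (sqn (meas a b) f)"
  let ?N = "L1_norm (meas a b)"
  let ?I = "\<lambda>p. LINT x|meas a b. complex_of_real (p x) * prim a b f x"
  let ?d = "?N (\<lambda>x. p x - q x)"
  have K: "0 \<le> ?K" using assms(1) by simp
  have f: "integrable (meas a b) f" by (intro integrable_of_sq finite_meas assms)
  have pq: "integrable (meas a b) (\<lambda>x. p x - q x)" using assms by simp
  have "?I p - ?I q = (LINT x|meas a b. complex_of_real (p x) * prim a b f x - complex_of_real (q x) * prim a b f x)"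
    by (subst Bochner_Integration.integral_diff) (auto intro!: prim_bounded_mult f simp: assms)
  also have "\<dots> = ?I (\<lambda>x. p x - q x)"
    by (simp add: algebra_simps)
  finally have Id: "cmod (?I p - ?I q) \<le> ?d * ?K"
    using integral_mult_prim_le[OF assms(1,2) pq] by simp
  have Nd: "\<bar>?N q - ?N p\<bar> \<le> ?d"
  proof -
    have "?N q - ?N p = (LINT x|meas a b. \<bar>q x\<bar> - \<bar>p x\<bar>)"
      unfolding L1_norm_def using assms by simp
    also have "\<bar>\<dots>\<bar> \<le> (LINT x|meas a b. \<bar>\<bar>q x\<bar> - \<bar>p x\<bar>\<bar>)"
      by (rule integral_abs_bound)
    also have "\<dots> \<le> ?d"
      unfolding L1_norm_def by (rule integral_mono) (use assms in auto)
    finally show ?thesis .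
  qed
  have "flux a b p f x - flux a b q f x = ?I p / of_real (?N p) - ?I q / of_real (?N q)"
    by (simp add: flux_def flux_const_def)
  also have "\<dots> = (?I p - ?I q) / of_real (?N q) + (?I p / of_real (?N p)) * of_real (?N q - ?N p) / of_real (?N q)"
    using p q by (simp add: field_simps)
  finally have eq: "flux a b p f x - flux a b q f x
      = (?I p - ?I q) / of_real (?N q) + flux_const a b p f * of_real (?N q - ?N p) / of_real (?N q)"
    by (simp add: flux_const_def)
  have "cmod (flux a b p f x - flux a b q f x)
      \<le> cmod ((?I p - ?I q) / of_real (?N q)) + cmod (flux_const a b p f * of_real (?N q - ?N p) / of_real (?N q))"
    unfolding eq by (rule norm_triangle_ineq)
  also have "\<dots> = cmod (?I p - ?I q) / ?N q + cmod (flux_const a b p f) * \<bar>?N q - ?N p\<bar> / ?N q"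
    using q by (simp only: norm_divide norm_mult norm_of_real)
  also have "\<dots> \<le> ?d * ?K / ?N q + ?K * ?d / ?N q"
    by (intro add_mono divide_right_mono mult_mono Id Nd flux_const_le assms K) auto
  also have "\<dots> = 2 * ?d / ?N q * ?K" by (simp add: field_simps)
  finally show ?thesis .
qed

text \<open>
  Split \<open>p F\<^sub>p - q F\<^sub>q = (p - q) F\<^sub>p + q (F\<^sub>p - F\<^sub>q)\<close> for the fluxes \<open>F\<^sub>p\<close> and \<open>F\<^sub>q\<close>. In the second summand the
  factor \<open>\<parallel>q\<parallel>\<^sub>1\<close> cancels the denominator of the flux estimate.
\<close>

lemma potential_diff_le:
  assumes "a < b" "f \<in> sq_integrable (meas a b)" "integrable (meas a b) p" "integrable (meas a b) q"
    and q: "L1_norm (meas a b) q > 0" and p: "L1_norm (meas a b) p > 0"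
  shows "cmod (potential a b p f x - potential a b q f x)
    \<le> 4 * L1_norm (meas a b) (\<lambda>x. p x - q x) * (sqrt (b - a) * sqrt (sqn (meas a b) f))"
proof -
  let ?K = "sqrt (b - a) * sqrt (sqn (meas a b) f)"
  let ?N = "L1_norm (meas a b)"
  let ?d = "?N (\<lambda>x. p x - q x)"
  let ?g = "\<lambda>y. of_real (p y) * flux a b p f y - of_real (q y) * flux a b q f y"
  have K: "0 \<le> ?K" using assms(1) by simp
  have f: "integrable (meas a b) f" by (intro integrable_of_sq finite_meas assms)
  have g: "integrable (meas a b) ?g"
    by (intro Bochner_Integration.integrable_diff integrable_mult_flux f assms)
  have "potential a b p f x - potential a b q f x = prim a b ?g x"
    unfolding potential_def by (rule prim_diff[symmetric]) (intro integrable_mult_flux f assms)+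
  then have "cmod (potential a b p f x - potential a b q f x) \<le> (LINT y|meas a b. cmod (?g y))"
    using prim_bound[OF g] by simp
  also have "\<dots> \<le> (LINT y|meas a b. \<bar>p y - q y\<bar> * (2 * ?K) + \<bar>q y\<bar> * (2 * ?d / ?N q * ?K))"
  proof (rule integral_mono)
    show "cmod (?g y) \<le> \<bar>p y - q y\<bar> * (2 * ?K) + \<bar>q y\<bar> * (2 * ?d / ?N q * ?K)" for y
    proof -
      have "?g y = of_real (p y - q y) * flux a b p f y + of_real (q y) * (flux a b p f y - flux a b q f y)"
        by (simp add: algebra_simps)
      then have "cmod (?g y) \<le> \<bar>p y - q y\<bar> * cmod (flux a b p f y)
          + \<bar>q y\<bar> * cmod (flux a b p f y - flux a b q f y)"
        by (metis norm_triangle_ineq norm_mult norm_of_real)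
      also have "\<dots> \<le> \<bar>p y - q y\<bar> * (2 * ?K) + \<bar>q y\<bar> * (2 * ?d / ?N q * ?K)"
        by (intro add_mono mult_left_mono flux_le flux_diff_le assms) auto
      finally show ?thesis .
    qed
  qed (use g assms in auto)
  also have "\<dots> = ?d * (2 * ?K) + ?N q * (2 * ?d / ?N q * ?K)"
    using assms by (simp add: L1_norm_def)
  also have "\<dots> = 4 * ?d * ?K" using q by (simp add: field_simps)
  finally show ?thesis .
qed

section \<open>Smooth functions and test functions\<close>

text \<open>
  Peeling derivatives off from the inside makes closure properties provable by a plain induction in
  which the function varies.
\<close>

fun times_differentiable :: "nat \<Rightarrow> (real \<Rightarrow> complex) \<Rightarrow> bool" where
  "times_differentiable 0 f = True"
| "times_differentiable (Suc n) f =
     ((\<forall>x. f differentiable (at x)) \<and> times_differentiable n (vderiv f))"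

lemma times_differentiable_iff:
  "times_differentiable n f \<longleftrightarrow> (\<forall>k<n. \<forall>x. (vderiv ^^ k) f differentiable (at x))"
proof (induction n arbitrary: f)
  case (Suc n)
  have "(\<forall>k<Suc n. \<forall>x. (vderiv ^^ k) f differentiable (at x)) \<longleftrightarrow>
      (\<forall>x. f differentiable (at x)) \<and> (\<forall>k<n. \<forall>x. (vderiv ^^ Suc k) f differentiable (at x))"
    by (subst All_less_Suc2) simp
  then show ?case
    by (simp add: Suc.IH funpow_swap1)
qed simp

lemma smooth_iff: "smooth f \<longleftrightarrow> (\<forall>n. times_differentiable n f)"
  unfolding smooth_def times_differentiable_iff by auto

lemma vderiv_eq: "(\<And>x. (f has_vector_derivative g x) (at x)) \<Longrightarrow> vderiv f = g"
  by (auto simp: vderiv_def intro!: ext vector_derivative_at)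

lemma times_differentiable_SucI:
  assumes "\<And>x. (f has_vector_derivative g x) (at x)" "times_differentiable n g"
  shows "times_differentiable (Suc n) f"
  using assms differentiableI_vector[OF assms(1)] by (simp add: vderiv_eq[OF assms(1)])

lemma has_vderiv: "f differentiable (at x) \<Longrightarrow> (f has_vector_derivative vderiv f x) (at x)"
  by (simp add: vderiv_def vector_derivative_works)

lemma times_differentiable_SucD: "times_differentiable (Suc n) f \<Longrightarrow> times_differentiable n f"
  by (simp only: times_differentiable_iff) auto

lemma times_differentiable_add:
  "times_differentiable n f \<Longrightarrow> times_differentiable n g \<Longrightarrow> times_differentiable n (\<lambda>x. f x + g x)"
proof (induction n arbitrary: f g)
  case (Suc n)
  show ?case
    by (rule times_differentiable_SucI[where g="\<lambda>x. vderiv f x + vderiv g x"])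
       (use Suc in \<open>auto intro!: derivative_intros has_vderiv\<close>)
qed simp

lemma times_differentiable_mult:
  "times_differentiable n f \<Longrightarrow> times_differentiable n g \<Longrightarrow> times_differentiable n (\<lambda>x. f x * g x)"
proof (induction n arbitrary: f g)
  case (Suc n)
  show ?case
  proof (rule times_differentiable_SucI)
    show "((\<lambda>x. f x * g x) has_vector_derivative (f x * vderiv g x + vderiv f x * g x)) (at x)" for x
      using Suc.prems by (auto intro!: has_vector_derivative_mult has_vderiv)
    show "times_differentiable n (\<lambda>x. f x * vderiv g x + vderiv f x * g x)"
      using Suc.prems times_differentiable_SucD[OF Suc.prems(1)] times_differentiable_SucD[OF Suc.prems(2)]
      by (intro times_differentiable_add Suc.IH) auto
  qed
qed simp

lemma smooth_mult: "smooth f \<Longrightarrow> smooth g \<Longrightarrow> smooth (\<lambda>x. f x * g x)"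
  and smooth_add: "smooth f \<Longrightarrow> smooth g \<Longrightarrow> smooth (\<lambda>x. f x + g x)"
  by (simp_all add: smooth_iff times_differentiable_mult times_differentiable_add)

lemma smooth_polynomial: "polynomial_function f \<Longrightarrow> smooth f"
proof -
  have "polynomial_function f \<Longrightarrow> times_differentiable n f" for n and f :: "real \<Rightarrow> complex"
  proof (induction n arbitrary: f)
    case (Suc n)
    obtain f' where "polynomial_function f'" "\<And>x. (f has_vector_derivative f' x) (at x)"
      using has_vector_derivative_polynomial_function[OF Suc.prems] by blast
    then show ?case by (intro times_differentiable_SucI Suc.IH)
  qed simp
  then show "polynomial_function f \<Longrightarrow> smooth f" by (simp add: smooth_iff)
qed

lemma smooth_const: "smooth (\<lambda>x. c)"
  by (rule smooth_polynomial) simp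

lemma times_differentiable_affine:
  "times_differentiable n f \<Longrightarrow> times_differentiable n (\<lambda>x. f (c * x + d))"
proof (induction n arbitrary: f)
  case (Suc n)
  show ?case
  proof (rule times_differentiable_SucI)
    fix x
    have "((\<lambda>x. c * x + d) has_vector_derivative c) (at x)"
      by (auto intro!: derivative_eq_intros)
    from vector_diff_chain_at[OF this has_vderiv] Suc.prems
    have "((f \<circ> (\<lambda>x. c * x + d)) has_vector_derivative c *\<^sub>R vderiv f (c * x + d)) (at x)" by simp
    then show "((\<lambda>x. f (c * x + d)) has_vector_derivative of_real c * vderiv f (c * x + d)) (at x)"
      by (simp add: o_def scaleR_conv_of_real)
  next
    show "times_differentiable n (\<lambda>x. of_real c * vderiv f (c * x + d))"
      using Suc smooth_const[of "of_real c"] by (intro times_differentiable_mult) (auto simp: smooth_iff)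
  qed
qed simp

text \<open>
  The functions \<open>x\<^sup>-\<^sup>k e\<^sup>-\<^sup>1\<^sup>/\<^sup>x\<close>, extended by zero to the left half-line. Their linear span is closed under
  differentiation, so that all of them are smooth, also at the origin.
\<close>

definition flat :: "nat \<Rightarrow> real \<Rightarrow> real" where
  "flat k x = (if 0 < x then inverse x ^ k * exp (- inverse x) else 0)"

text \<open>
  At the origin the difference quotient of the \<open>k\<close>-th function is the \<open>(k + 1)\<close>-st, which tends to
  zero since \<open>t\<^sup>k\<^sup>+\<^sup>1 e\<^sup>-\<^sup>t\<close> does for \<open>t \<rightarrow> \<infinity>\<close>.
\<close>

lemma flat_deriv:
  "(flat k has_field_derivative (flat (Suc (Suc k)) x - real k * flat (Suc k) x)) (at x)"
proof -
  consider "x > 0" | "x < 0" | "x = 0" by linarith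
  then show ?thesis
  proof cases
    case 1
    have pow: "((\<lambda>x. inverse x ^ k) has_field_derivative - (real k * inverse x ^ Suc k)) (at x)"
      using DERIV_power[OF DERIV_inverse, of x k UNIV] 1 by (cases k) (simp_all add: mult_ac)
    have exp: "((\<lambda>x. exp (- inverse x)) has_field_derivative inverse x ^ 2 * exp (- inverse x)) (at x)"
      using 1 by (auto intro!: derivative_eq_intros simp: power2_eq_square field_simps)
    have "((\<lambda>x. inverse x ^ k * exp (- inverse x)) has_field_derivative
        (flat (Suc (Suc k)) x - real k * flat (Suc k) x)) (at x)"
      using DERIV_mult[OF pow exp] 1 by (simp add: flat_def power2_eq_square algebra_simps)
    then show ?thesis
      by (rule has_field_derivative_transform_within_open[where S="{0<..}"]) (use 1 in \<open>auto simp: flat_def\<close>)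
  next
    case 2
    have "((\<lambda>x. 0) has_field_derivative (0::real)) (at x)" by simp
    then have "(flat k has_field_derivative 0) (at x)"
      by (rule has_field_derivative_transform_within_open[where S="{..<0}"]) (use 2 in \<open>auto simp: flat_def\<close>)
    then show ?thesis using 2 by (simp add: flat_def)
  next
    case 3
    have "((\<lambda>h. flat (Suc k) h) \<longlongrightarrow> 0) (at_right 0)"
    proof (rule Lim_transform_eventually)
      have "((\<lambda>t. t ^ Suc k / exp t) \<longlongrightarrow> (0::real)) at_top" by (rule tendsto_power_div_exp_0)
      then show "((\<lambda>h. inverse h ^ Suc k / exp (inverse h)) \<longlongrightarrow> (0::real)) (at_right 0)"
        by (rule filterlim_compose[OF _ filterlim_inverse_at_top_right])
      show "\<forall>\<^sub>F h in at_right 0. inverse h ^ Suc k / exp (inverse h) = flat (Suc k) (h::real)"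
        by (auto simp: eventually_at_filter flat_def exp_minus divide_inverse)
    qed
    then have r: "((\<lambda>h. flat k h / h) \<longlongrightarrow> 0) (at_right 0)"
      by (rule Lim_transform_eventually) (auto simp: eventually_at_filter flat_def divide_inverse)
    have "((\<lambda>h. 0) \<longlongrightarrow> (0::real)) (at_left 0)" by simp
    then have l: "((\<lambda>h. flat k h / h) \<longlongrightarrow> 0) (at_left 0)"
      by (rule Lim_transform_eventually) (auto simp: eventually_at_filter flat_def)
    from l r have "((\<lambda>h. (flat k (0 + h) - flat k 0) / h) \<longlongrightarrow> 0) (at 0)"
      by (simp add: filterlim_at_split flat_def[of k 0])
    then show ?thesis using 3 by (simp add: DERIV_def flat_def[of _ 0])
  qed
qed

lemma smooth_flat: "smooth (\<lambda>x. of_real (flat k x))"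
proof -
  have "times_differentiable n (\<lambda>x. of_real (flat k x))" for n
  proof (induction n arbitrary: k)
    case (Suc n)
    show ?case
    proof (rule times_differentiable_SucI)
      show "((\<lambda>x. complex_of_real (flat k x)) has_vector_derivative
          of_real (flat (Suc (Suc k)) x) + of_real (- real k) * of_real (flat (Suc k) x)) (at x)" for x
        using has_vector_derivative_of_real[OF flat_deriv[of k x], where 'a=complex] by simp
      show "times_differentiable n
          (\<lambda>x. of_real (flat (Suc (Suc k)) x) + of_real (- real k) * of_real (flat (Suc k) x))"
        by (intro times_differentiable_add times_differentiable_mult Suc.IH)
           (use smooth_const in \<open>simp add: smooth_iff\<close>)
    qed
  qed simp
  then show ?thesis by (simp add: smooth_iff)
qed

lemma flat0: "flat 0 x = (if 0 < x then exp (- inverse x) else 0)"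
  by (simp add: flat_def)

text \<open>
  Smooth functions with support in \<open>[a + 1/k, b - 1/k]\<close> that tend to one at each point of the interval
  as \<open>k \<rightarrow> \<infinity>\<close>. Pointwise convergence suffices for dominated convergence, so there is no need for
  a plateau on which they equal one.
\<close>

definition cutoff :: "real \<Rightarrow> real \<Rightarrow> nat \<Rightarrow> real \<Rightarrow> real" where
  "cutoff a b k x = flat 0 (real k * (x - a) - 1) * flat 0 (real k * (b - x) - 1)"

lemma smooth_cutoff: "smooth (\<lambda>x. of_real (cutoff a b k x))"
proof -
  have "smooth (\<lambda>x. complex_of_real (flat 0 (c * x + d)))" for c d
    using smooth_flat[of 0] times_differentiable_affine[of _ "\<lambda>x. complex_of_real (flat 0 x)" c d]
    by (simp add: smooth_iff)
  from smooth_mult[OF this[of "real k" "- real k * a - 1"] this[of "- real k" "real k * b - 1"]]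
  show ?thesis by (simp add: cutoff_def algebra_simps)
qed

lemma cutoff_range: "0 \<le> cutoff a b k x" "cutoff a b k x \<le> 1"
  by (auto simp: cutoff_def flat0 intro!: mult_le_one)

lemma cutoff_tendsto:
  assumes "a < x" "x < b"
  shows "(\<lambda>k. cutoff a b k x) \<longlonglongrightarrow> 1"
proof -
  have "(\<lambda>k. flat 0 (real k * c - 1)) \<longlonglongrightarrow> 1" if "0 < c" for c
  proof -
    have top: "filterlim (\<lambda>k. real k * c - 1) at_top sequentially"
      using filterlim_at_top_mult_tendsto_pos[OF tendsto_const[of c] that filterlim_real_sequentially]
      by (intro filterlim_tendsto_add_at_top[where c="-1", OF tendsto_const, simplified add.commute, simplified])
         (simp_all add: mult.commute)
    have "(\<lambda>k. exp (- inverse (real k * c - 1))) \<longlonglongrightarrow> exp (- 0)"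
      by (intro tendsto_exp tendsto_minus filterlim_compose[OF tendsto_inverse_0_at_top top])
         (rule filterlim_ident)
    then have "(\<lambda>k. exp (- inverse (real k * c - 1))) \<longlonglongrightarrow> 1" by simp
    moreover have "\<forall>\<^sub>F k in sequentially. 0 < real k * c - 1"
      using top unfolding filterlim_at_top_dense by blast
    then have "\<forall>\<^sub>F k in sequentially. exp (- inverse (real k * c - 1)) = flat 0 (real k * c - 1)"
      by eventually_elim (simp add: flat0)
    ultimately show ?thesis
      by (rule Lim_transform_eventually)
  qed
  from tendsto_mult[OF this[of "x - a"] this[of "b - x"]] assms
  show ?thesis by (simp add: cutoff_def)
qed

lemma test_functionsI:
  assumes "smooth f" "a < c" "d < b" "\<And>x. x \<notin> {c..d} \<Longrightarrow> f x = 0"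
  shows "f \<in> test_functions {a<..<b}"
proof -
  have sub: "closure {x. f x \<noteq> 0} \<subseteq> {c..d}"
  proof (rule closure_minimal)
    show "{x. f x \<noteq> 0} \<subseteq> {c..d}" using assms(4) by blast
  qed simp
  moreover have "compact (closure {x. f x \<noteq> 0})"
    using sub by (meson bounded_closed_interval bounded_subset closed_closure compact_eq_bounded_closed)
  ultimately show ?thesis
    using assms(1-3) by (auto simp: test_functions_def subset_iff)
qed

lemma test_functionsE:
  assumes "f \<in> test_functions {a<..<b}" "a < b"
  obtains c d where "a < c" "c < d" "d < b" "\<And>x. x \<notin> {c..d} \<Longrightarrow> f x = 0"
proof -
  \<comment> \<open>The two inner points make the compact set nonempty and give it positive diameter, so that
    the zero function needs no separate treatment.\<close>
  define K where "K = insert ((2*a + b)/3) (insert ((a+2*b)/3) (closure {x. f x \<noteq> 0}))"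
  have K: "compact K" "K \<noteq> {}" "K \<subseteq> {a<..<b}"
    using assms by (auto simp: test_functions_def K_def field_simps intro!: compact_insert)
  obtain c where c: "c \<in> K" "\<And>x. x \<in> K \<Longrightarrow> c \<le> x"
    using compact_attains_inf[OF K(1,2)] by blast
  obtain d where d: "d \<in> K" "\<And>x. x \<in> K \<Longrightarrow> x \<le> d"
    using compact_attains_sup[OF K(1,2)] by blast
  show thesis
  proof (rule that)
    show "a < c" "d < b" using c(1) d(1) K(3) by auto
    have "c \<le> (2*a+b)/3" by (rule c(2)) (simp add: K_def)
    moreover have "(a+2*b)/3 \<le> d" by (rule d(2)) (simp add: K_def)
    ultimately show "c < d" using assms(2) by (simp add: field_simps)
    show "f x = 0" if "x \<notin> {c..d}" for x
      using that c(2)[of x] d(2)[of x] closure_subset[of "{x. f x \<noteq> 0}"] by (auto simp: K_def)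
  qed
qed

lemma cutoff_mult_test:
  assumes "smooth g"
  shows "(\<lambda>x. of_real (cutoff a b k x) * g x) \<in> test_functions {a<..<b}"
proof (cases "k = 0")
  case True
  \<comment> \<open>For this index both factors of the cutoff have argument \<open>-1\<close>.\<close>
  then have z: "(\<lambda>x. of_real (cutoff a b k x) * g x) = (\<lambda>x. 0)" by (simp add: cutoff_def flat0)
  show ?thesis unfolding z by (simp add: test_functions_def smooth_const)
next
  case False
  show ?thesis
  proof (rule test_functionsI[where c="a + 1 / k" and d="b - 1 / k"])
    show "smooth (\<lambda>x. of_real (cutoff a b k x) * g x)"
      by (intro smooth_mult smooth_cutoff assms)
    show "of_real (cutoff a b k x) * g x = 0" if "x \<notin> {a + 1/k..b - 1/k}" for x
      using that False by (auto simp: cutoff_def flat0 field_simps)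
  qed (use False in auto)
qed

lemma smooth_differentiable: "smooth f \<Longrightarrow> f differentiable (at x)"
  unfolding smooth_def by (drule spec[of _ 0]) simp

lemma smooth_vderiv: "smooth f \<Longrightarrow> smooth (vderiv f)"
  unfolding smooth_iff by (metis times_differentiable.simps(2))

lemma smooth_continuous: "smooth f \<Longrightarrow> continuous_on UNIV f"
  by (simp add: continuous_at_imp_continuous_on differentiable_imp_continuous_within smooth_differentiable)

lemma test_smooth: "f \<in> test_functions I \<Longrightarrow> smooth f"
  by (simp add: test_functions_def)

lemma test_vderiv:
  assumes "f \<in> test_functions {a<..<b}" "a < b"
  shows "vderiv f \<in> test_functions {a<..<b}"
proof -
  obtain c d where cd: "a < c" "c < d" "d < b" "\<And>x. x \<notin> {c..d} \<Longrightarrow> f x = 0"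
    using test_functionsE[OF assms] by blast
  show ?thesis
  proof (rule test_functionsI[OF smooth_vderiv[OF test_smooth[OF assms(1)]] cd(1,3)])
    fix x assume x: "x \<notin> {c..d}"
    have "((\<lambda>x. 0) has_vector_derivative 0) (at x)" by simp
    then have "(f has_vector_derivative 0) (at x)"
      by (rule has_vector_derivative_transform_within_open[where S="- {c..d}"]) (use x cd(4) in auto)
    then show "vderiv f x = 0" by (simp add: vderiv_def vector_derivative_at)
  qed
qed

lemma sq_integrable_continuous:
  assumes "continuous_on UNIV f"
  shows "f \<in> sq_integrable (meas a b)"
proof -
  have "compact (f ` {a..b})"
    by (intro compact_continuous_image continuous_on_subset[OF assms]) auto
  then obtain K where "\<And>x. x \<in> {a..b} \<Longrightarrow> cmod (f x) \<le> K"
    by (meson bounded_iff compact_imp_bounded imageI)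
  then show ?thesis
    by (intro sq_integrable_bounded[OF finite_meas continuous_measurable_meas[OF assms], where K=K]
          AE_I2) auto
qed

lemma test_sq_integrable: "f \<in> test_functions {a<..<b} \<Longrightarrow> f \<in> sq_integrable (meas a b)"
  by (intro sq_integrable_continuous smooth_continuous test_smooth)

lemma test_add:
  assumes "f \<in> test_functions {a<..<b}" "g \<in> test_functions {a<..<b}" "a < b"
  shows "(\<lambda>x. f x + g x) \<in> test_functions {a<..<b}"
proof -
  obtain c d where cd: "a < c" "c < d" "d < b" "\<And>x. x \<notin> {c..d} \<Longrightarrow> f x = 0"
    using test_functionsE[OF assms(1,3)] by blast
  obtain c' d' where cd': "a < c'" "c' < d'" "d' < b" "\<And>x. x \<notin> {c'..d'} \<Longrightarrow> g x = 0"
    using test_functionsE[OF assms(2,3)] by blast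
  show ?thesis
  proof (rule test_functionsI[where c="min c c'" and d="max d d'"])
    show "f x + g x = 0" if "x \<notin> {min c c'..max d d'}" for x
    proof -
      from that have "x \<notin> {c..d}" "x \<notin> {c'..d'}" by (auto simp: min_le_iff_disj le_max_iff_disj)
      then show ?thesis by (simp add: cd(4) cd'(4))
    qed
  qed (use cd cd' smooth_add[OF assms(1,2)[THEN test_smooth]] in auto)
qed

lemma test_scale:
  assumes "f \<in> test_functions {a<..<b}" "a < b"
  shows "(\<lambda>x. k * f x) \<in> test_functions {a<..<b}"
proof -
  obtain c d where cd: "a < c" "c < d" "d < b" "\<And>x. x \<notin> {c..d} \<Longrightarrow> f x = 0"
    using test_functionsE[OF assms] by blast
  show ?thesis
    by (rule test_functionsI[where c=c and d=d])
       (use cd smooth_mult[OF smooth_const test_smooth[OF assms(1)]] in auto)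
qed

section \<open>The fundamental theorem of calculus for test functions\<close>

lemma prim_FTC:
  assumes "\<And>x. x \<in> {a..b} \<Longrightarrow> (F has_vector_derivative f x) (at x within {a..b})"
    and f: "continuous_on UNIV f" and x: "x \<in> {a..b}"
  shows "prim a b f x = F x - F a"
proof -
  have ax: "a \<le> x" "x \<le> b" using x by auto
  have fb: "f \<in> borel_measurable borel" using f by (rule borel_measurable_continuous_onI)
  then have [measurable]: "f \<in> borel_measurable lborel" by simp
  have "prim a b f x = (LINT y|lebesgue. indicator {a<..<b} y *\<^sub>R (if y < x then f y else 0))"
    unfolding prim_def by (simp add: integral_restrict_space)
  also have "\<dots> = (LINT y|lborel. indicator {a<..<b} y *\<^sub>R (if y < x then f y else 0))"
    by (rule integral_completion) measurable
  also have "\<dots> = (LINT y|lborel. indicator {a..x} y *\<^sub>R f y)"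
  proof (rule integral_cong_AE)
    show "AE y in lborel. indicator {a<..<b} y *\<^sub>R (if y < x then f y else 0) = indicator {a..x} y *\<^sub>R f y"
      using AE_lborel_singleton[of a] AE_lborel_singleton[of x]
      by eventually_elim (use ax in \<open>auto simp: indicator_def\<close>)
  qed measurable
  also have "\<dots> = F x - F a"
  proof (rule integral_FTC_Icc[OF ax(1)])
    show "(F has_vector_derivative f y) (at y within {a..x})" if "a \<le> y" "y \<le> x" for y
      using assms(1)[of y] that ax by (auto intro: has_vector_derivative_within_subset)
  qed (rule continuous_on_subset[OF f], simp)
  finally show ?thesis .
qed

lemma prim_vderiv:
  assumes "f \<in> test_functions {a<..<b}" "x \<in> {a..b}" "a < b"
  shows "prim a b (vderiv f) x = f x"
proof -
  obtain c d where cd: "a < c" "c < d" "d < b" "\<And>x. x \<notin> {c..d} \<Longrightarrow> f x = 0"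
    using test_functionsE[OF assms(1,3)] by blast
  have "prim a b (vderiv f) x = f x - f a"
  proof (rule prim_FTC)
    have sm: "smooth f" by (rule test_smooth[OF assms(1)])
    show "(f has_vector_derivative vderiv f x) (at x within {a..b})" for x
      by (rule has_vector_derivative_at_within[OF has_vderiv[OF smooth_differentiable[OF sm]]])
    show "continuous_on UNIV (vderiv f)" by (rule smooth_continuous[OF smooth_vderiv[OF sm]])
  qed (rule assms(2))
  then show ?thesis using cd by simp
qed

lemma integral_vderiv:
  assumes "f \<in> test_functions {a<..<b}" "a < b"
  shows "(LINT x|meas a b. vderiv f x) = 0"
proof -
  obtain c d where cd: "a < c" "c < d" "d < b" "\<And>x. x \<notin> {c..d} \<Longrightarrow> f x = 0"
    using test_functionsE[OF assms] by blast
  have "prim a b (vderiv f) b = f b" using assms by (intro prim_vderiv) auto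
  then show ?thesis using cd by (simp add: prim_end)
qed

lemma tail_vderiv:
  assumes "f \<in> test_functions {a<..<b}" "y \<in> {a..b}" "a < b"
  shows "tail a b (vderiv f) y = - f y"
proof -
  have int: "integrable (meas a b) (vderiv f)"
    by (rule integrable_of_sq[OF finite_meas test_sq_integrable[OF test_vderiv[OF assms(1,3)]]])
  have [measurable]: "vderiv f \<in> borel_measurable (meas a b)" using int by simp
  have sing: "AE x in meas a b. x \<noteq> y"
    using AE_completion[OF AE_lborel_singleton[of y]] by (auto simp: AE_restrict_space_iff elim: eventually_mono)
  have "prim a b (vderiv f) y + tail a b (vderiv f) y =
     (LINT x|meas a b. (if x < y then vderiv f x else 0) + (if y < x then vderiv f x else 0))"
    unfolding prim_def tail_def using integrable_restrict_less[OF int] by simp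
  also have "\<dots> = (LINT x|meas a b. vderiv f x)"
    by (rule integral_cong_AE) (use sing in \<open>auto elim!: eventually_mono\<close>)
  finally show ?thesis
    using prim_vderiv[OF assms] integral_vderiv[OF assms(1,3)] by (simp add: add_eq_0_iff2)
qed

text \<open>
  Mean value zero is what makes the primitive vanish to the right of the support. So the derivatives
  of test functions are exactly the test functions with mean value zero.
\<close>

lemma antiderivative_test:
  assumes f: "f \<in> test_functions {a<..<b}" and "a < b" and z: "(LINT x|meas a b. f x) = 0"
  shows "prim a b f \<in> test_functions {a<..<b}" "vderiv (prim a b f) = f"
proof -
  obtain c d where cd: "a < c" "c < d" "d < b" "\<And>x. x \<notin> {c..d} \<Longrightarrow> f x = 0"
    using test_functionsE[OF f \<open>a < b\<close>] by blast
  have cont: "continuous_on UNIV f" using f by (intro smooth_continuous test_smooth)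
  have out: "prim a b f x = 0" if "x \<notin> {c..d}" for x
  proof -
    consider "x < c" | "x > d" using \<open>x \<notin> {c..d}\<close> by auto
    then show ?thesis
    proof cases
      case 1
      have "prim a b f x = (LINT y|meas a b. 0)"
        unfolding prim_def by (rule Bochner_Integration.integral_cong) (use 1 cd(4) in auto)
      then show ?thesis by simp
    next
      case 2
      have "prim a b f x = (LINT y|meas a b. f y)"
        unfolding prim_def by (rule Bochner_Integration.integral_cong) (use 2 cd(4) in auto)
      then show ?thesis using z by simp
    qed
  qed
  have deriv: "(prim a b f has_vector_derivative f x) (at x)" for x
  proof (cases "x \<in> {c..d}")
    case True
    obtain F where F: "\<And>x. x \<in> {a..b} \<Longrightarrow> (F has_vector_derivative f x) (at x within {a..b})"
      using antiderivative_continuous[OF continuous_on_subset[OF cont]] by blast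
    have x: "x \<in> {a<..<b}" using True cd by auto
    have "(F has_vector_derivative f x) (at x)"
      using F[of x] x by (simp add: at_within_Icc_at)
    then have "((\<lambda>y. F y - F a) has_vector_derivative f x) (at x)"
      by (auto intro!: derivative_eq_intros)
    then show ?thesis
      by (rule has_vector_derivative_transform_within_open[where S="{a<..<b}"])
         (use x prim_FTC[OF F cont] in auto)
  next
    case False
    have "((\<lambda>x. 0) has_vector_derivative 0) (at x)" by simp
    then have "(prim a b f has_vector_derivative 0) (at x)"
      by (rule has_vector_derivative_transform_within_open[where S="- {c..d}"]) (use False out in auto)
    then show ?thesis using cd(4)[OF False] by simp
  qed
  show v: "vderiv (prim a b f) = f" by (rule vderiv_eq[OF deriv])
  have "smooth (prim a b f)"
    unfolding smooth_iff
  proof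
    fix n
    have "times_differentiable n f" using test_smooth[OF f] by (simp add: smooth_iff)
    from times_differentiable_SucI[OF deriv this] show "times_differentiable n (prim a b f)"
      by (rule times_differentiable_SucD)
  qed
  then show "prim a b f \<in> test_functions {a<..<b}"
    by (rule test_functionsI[OF _ cd(1,3)]) (rule out)
qed

section \<open>Density of the test functions\<close>

lemma sqn_dominated_tendsto:
  assumes g: "g \<in> borel_measurable M" and s: "\<And>n. s n \<in> borel_measurable M"
    and w: "integrable M (\<lambda>x. (w x)\<^sup>2)"
    and lim: "AE x in M. (\<lambda>n. s n x) \<longlonglongrightarrow> g x"
    and bound: "\<And>n. AE x in M. cmod (g x - s n x) \<le> w x"
  shows "(\<lambda>n. sqn M (\<lambda>x. g x - s n x)) \<longlonglongrightarrow> 0"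
proof -
  note [measurable] = g s
  have "(\<lambda>n. sqn M (\<lambda>x. g x - s n x)) \<longlonglongrightarrow> (LINT x|M. 0)"
  proof (rule integral_dominated_convergence[OF _ _ w])
    show "AE x in M. (\<lambda>n. (cmod (g x - s n x))\<^sup>2) \<longlonglongrightarrow> 0"
      using lim
    proof eventually_elim
      case (elim x)
      from tendsto_norm[OF tendsto_diff[OF tendsto_const[of "g x"] this]]
      have "(\<lambda>n. cmod (g x - s n x)) \<longlonglongrightarrow> 0" by simp
      from tendsto_power[OF this, of 2] show ?case by simp
    qed
    show "AE x in M. norm ((cmod (g x - s n x))\<^sup>2) \<le> (w x)\<^sup>2" for n
      using bound[of n] by eventually_elim (simp add: power_mono)
  qed measurable
  then show ?thesis by simp
qed

lemma tendsto_zero_less: "(X \<longlonglongrightarrow> (0::real)) \<Longrightarrow> 0 < e \<Longrightarrow> \<exists>n. X n < e"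
  using order_tendstoD(2)[of X 0 sequentially e] by (auto simp: eventually_sequentially)

lemma sq_approx_bounded:
  assumes "g \<in> sq_integrable M" "0 < e"
  obtains h K where "h \<in> sq_integrable M" "\<And>x. cmod (h x) \<le> K" "0 < K" "sqn M (\<lambda>x. g x - h x) < e"
proof -
  note [measurable] = sq_integrable_measurable[OF assms(1)]
  let ?s = "\<lambda>n x. if cmod (g x) \<le> real n then g x else 0"
  have "(\<lambda>n. sqn M (\<lambda>x. g x - ?s n x)) \<longlonglongrightarrow> 0"
  proof (rule sqn_dominated_tendsto[where w="\<lambda>x. cmod (g x)"])
    show "AE x in M. (\<lambda>n. ?s n x) \<longlonglongrightarrow> g x"
    proof (rule AE_I2)
      fix x
      obtain N where N: "cmod (g x) \<le> real N" using real_arch_simple by blast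
      have "\<forall>\<^sub>F n in sequentially. ?s n x = g x"
        using eventually_ge_at_top[of N] by eventually_elim (use N in auto)
      then show "(\<lambda>n. ?s n x) \<longlonglongrightarrow> g x" by (rule tendsto_eventually)
    qed
  qed (use sq_integrable_integrable_sq[OF assms(1)] in auto)
  from tendsto_zero_less[OF this assms(2)] obtain n where n: "sqn M (\<lambda>x. g x - ?s n x) < e"
    by blast
  show thesis
  proof (rule that[OF _ _ _ n])
    have "integrable M (\<lambda>x. (cmod (?s n x))\<^sup>2)"
      by (rule Bochner_Integration.integrable_bound[OF sq_integrable_integrable_sq[OF assms(1)]]) auto
    then show "?s n \<in> sq_integrable M" by (simp add: sq_integrable_def)
    show "cmod (?s n x) \<le> real n + 1" for x by auto
  qed simp
qed

text \<open>
  A Lebesgue measurable function is an almost everywhere limit of continuous functions.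
  Retracting their values to the disc of radius \<open>K\<close> keeps this limit and provides the bound for
  dominated convergence.
\<close>

lemma sq_approx_continuous:
  assumes g: "g \<in> sq_integrable (meas a b)" "\<And>x. cmod (g x) \<le> K" "0 < K" "0 < e"
  obtains h where "continuous_on UNIV h" "sqn (meas a b) (\<lambda>x. g x - h x) < e"
proof -
  have "g measurable_on {a<..<b}"
    using sq_integrable_measurable[OF g(1)] by (simp add: measurable_on_iff_borel_measurable)
  then obtain N G where N: "negligible N" and G: "\<And>n. continuous_on UNIV (G n)"
    and lim: "\<And>x. x \<notin> N \<Longrightarrow> (\<lambda>n. G n x) \<longlonglongrightarrow> (if x \<in> {a<..<b} then g x else 0)"
    unfolding measurable_on_def by blast
  define h where "h n x = of_real (K / max K (cmod (G n x))) * G n x" for n x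
  have hc: "continuous_on UNIV (h n)" for n
    unfolding h_def using g(3) by (intro continuous_intros G) (auto simp: max_def)
  have hb: "cmod (h n x) \<le> K" for n x
    using g(3) by (auto simp: h_def norm_mult max_def norm_divide field_simps)
  have "(\<lambda>n. sqn (meas a b) (\<lambda>x. g x - h n x)) \<longlonglongrightarrow> 0"
  proof (rule sqn_dominated_tendsto[where w="\<lambda>x. K + K"])
    interpret finite_measure "meas a b" by (rule finite_meas)
    show "integrable (meas a b) (\<lambda>x. (K + K)\<^sup>2)" by simp
    have "AE x in lebesgue. x \<notin> N"
      using N by (intro AE_not_in) (simp add: negligible_iff_null_sets)
    then have "AE x in lebesgue. x \<in> {a<..<b} \<longrightarrow> (\<lambda>n. h n x) \<longlonglongrightarrow> g x"
    proof eventually_elim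
      case (elim x)
      show ?case
      proof
        assume "x \<in> {a<..<b}"
        with lim[OF elim] have "(\<lambda>n. G n x) \<longlonglongrightarrow> g x" by simp
        then have "(\<lambda>n. h n x) \<longlonglongrightarrow> of_real (K / max K (cmod (g x))) * g x"
          unfolding h_def using g(3) by (intro tendsto_intros) auto
        then show "(\<lambda>n. h n x) \<longlonglongrightarrow> g x"
          using g(2)[of x] g(3) by (simp add: max_absorb1)
      qed
    qed
    then show "AE x in meas a b. (\<lambda>n. h n x) \<longlonglongrightarrow> g x"
      by (simp add: AE_restrict_space_iff)
    show "AE x in meas a b. cmod (g x - h n x) \<le> K + K" for n
      by (rule AE_I2) (meson norm_triangle_ineq4 order_trans add_mono g(2) hb)
  qed (use sq_integrable_measurable[OF g(1)] continuous_measurable_meas[OF hc] in auto)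
  from tendsto_zero_less[OF this g(4)] hc that show thesis by blast
qed

lemma sq_approx_polynomial:
  assumes "continuous_on UNIV h" "0 < e" "a < b"
  obtains q where "polynomial_function q" "sqn (meas a b) (\<lambda>x. h x - q x) < e"
proof -
  define d where "d = sqrt (e / (2 * (b - a)))"
  have "d\<^sup>2 = e / (2 * (b - a))" using assms by (simp add: d_def)
  then have d: "0 < d" "(b - a) * d\<^sup>2 = e / 2"
    using assms by (simp_all add: d_def divide_simps)
  obtain q where q: "polynomial_function q" "\<forall>x\<in>{a..b}. cmod (h x - q x) < d"
    using Stone_Weierstrass_polynomial_function[OF compact_Icc continuous_on_subset[OF assms(1)] d(1)]
    by blast
  have "sqrt (sqn (meas a b) (\<lambda>x. h x - q x)) \<le> sqrt (measure (meas a b) (space (meas a b))) * d"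
    by (rule sqn_le_of_bound[OF finite_meas]) (use q d in \<open>auto intro: less_imp_le\<close>)
  also have "\<dots> = sqrt (b - a) * sqrt (d\<^sup>2)" using assms(3) d(1) by (simp add: measure_meas)
  also have "\<dots> = sqrt (e / 2)" by (simp only: d(2)[symmetric] real_sqrt_mult)
  finally have "sqn (meas a b) (\<lambda>x. h x - q x) \<le> e / 2" by simp
  also have "\<dots> < e" using assms(2) by simp
  finally show thesis using that q(1) by blast
qed

text \<open>
  Multiplication by the cutoff functions turns a smooth function into test functions.
\<close>

lemma sq_approx_test_smooth:
  assumes "smooth q" "0 < e"
  obtains \<psi> where "\<psi> \<in> test_functions {a<..<b}" "sqn (meas a b) (\<lambda>x. q x - \<psi> x) < e"
proof -
  let ?s = "\<lambda>k x. of_real (cutoff a b k x) * q x"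
  have q: "q \<in> sq_integrable (meas a b)" by (intro sq_integrable_continuous smooth_continuous assms)
  have t: "?s k \<in> test_functions {a<..<b}" for k by (rule cutoff_mult_test[OF assms(1)])
  have "(\<lambda>k. sqn (meas a b) (\<lambda>x. q x - ?s k x)) \<longlonglongrightarrow> 0"
  proof (rule sqn_dominated_tendsto[where w="\<lambda>x. cmod (q x)"])
    show "AE x in meas a b. (\<lambda>k. ?s k x) \<longlonglongrightarrow> q x"
    proof (rule AE_I2)
      fix x assume "x \<in> space (meas a b)"
      then have "(\<lambda>k. ?s k x) \<longlonglongrightarrow> of_real 1 * q x"
        by (intro tendsto_intros cutoff_tendsto) auto
      then show "(\<lambda>k. ?s k x) \<longlonglongrightarrow> q x" by simp
    qed
    show "AE x in meas a b. cmod (q x - ?s k x) \<le> cmod (q x)" for k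
    proof (rule AE_I2)
      fix x
      have "q x - ?s k x = of_real (1 - cutoff a b k x) * q x" by (simp add: algebra_simps)
      then have "cmod (q x - ?s k x) = \<bar>1 - cutoff a b k x\<bar> * cmod (q x)" by (metis norm_mult norm_of_real)
      also have "\<dots> \<le> cmod (q x)"
        using cutoff_range[of a b k x] by (intro mult_left_le_one_le) auto
      finally show "cmod (q x - ?s k x) \<le> cmod (q x)" .
    qed
  qed (use sq_integrable_measurable[OF q] sq_integrable_integrable_sq[OF q]
        sq_integrable_measurable[OF test_sq_integrable[OF t]] in auto)
  from tendsto_zero_less[OF this assms(2)] t that show thesis by blast
qed

lemma sqn_diff_trans:
  assumes "f \<in> sq_integrable M" "g \<in> sq_integrable M" "h \<in> sq_integrable M"
    "sqn M (\<lambda>x. f x - g x) < e / 4" "sqn M (\<lambda>x. g x - h x) < e / 4"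
  shows "sqn M (\<lambda>x. f x - h x) < e"
  using sqn_add_le[OF sq_integrable_diff[OF assms(1,2)] sq_integrable_diff[OF assms(2,3)]] assms(4,5)
  by simp

text \<open>
  Truncate to a bounded function, then pass to a continuous one, to a polynomial by the theorem
  of Weierstrass, and finally cut off. Each use of the weak triangle inequality costs a factor of four.
\<close>

lemma test_functions_dense:
  assumes g: "g \<in> sq_integrable (meas a b)" and e: "0 < e" and ab: "a < b"
  obtains \<psi> where "\<psi> \<in> test_functions {a<..<b}" "sqn (meas a b) (\<lambda>x. g x - \<psi> x) < e"
proof -
  obtain g1 K where g1: "g1 \<in> sq_integrable (meas a b)" "\<And>x. cmod (g1 x) \<le> K" "0 < K"
    "sqn (meas a b) (\<lambda>x. g x - g1 x) < e / 4"
    using sq_approx_bounded[OF g, of "e / 4"] e by auto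
  obtain h where h: "continuous_on UNIV h" "sqn (meas a b) (\<lambda>x. g1 x - h x) < e / 4 / 4"
    using sq_approx_continuous[OF g1(1-3), of "e / 4 / 4"] e by auto
  obtain q where q: "polynomial_function q" "sqn (meas a b) (\<lambda>x. h x - q x) < e / 4 / 4 / 4"
    using sq_approx_polynomial[OF h(1), of "e / 4 / 4 / 4"] e ab by auto
  obtain \<psi> where \<psi>: "\<psi> \<in> test_functions {a<..<b}"
    "sqn (meas a b) (\<lambda>x. q x - \<psi> x) < e / 4 / 4 / 4"
    using sq_approx_test_smooth[OF smooth_polynomial[OF q(1)], of "e / 4 / 4 / 4"] e by auto
  have sq: "h \<in> sq_integrable (meas a b)" "q \<in> sq_integrable (meas a b)" "\<psi> \<in> sq_integrable (meas a b)"
    using h(1) smooth_continuous[OF smooth_polynomial[OF q(1)]] \<psi>(1)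
    by (auto intro: sq_integrable_continuous test_sq_integrable)
  have "sqn (meas a b) (\<lambda>x. h x - \<psi> x) < e / 4 / 4"
    by (rule sqn_diff_trans[OF sq q(2) \<psi>(2)])
  from sqn_diff_trans[OF g1(1) sq(1,3) h(2) this]
  have "sqn (meas a b) (\<lambda>x. g1 x - \<psi> x) < e / 4" .
  from sqn_diff_trans[OF g g1(1) sq(3) g1(4) this] \<psi>(1) that show thesis by blast
qed

text \<open>
  If \<open>g\<close> is orthogonal to all test functions \<open>\<psi>\<close>, then \<open>\<parallel>g\<parallel>\<^sup>2 = \<langle>g, g - \<psi>\<rangle> \<le> \<parallel>g\<parallel> \<parallel>g - \<psi>\<parallel>\<close>, and the last
  factor can be made smaller than \<open>\<parallel>g\<parallel>\<close>.
\<close>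

lemma orthogonal_test_imp_zero:
  assumes g: "g \<in> sq_integrable (meas a b)" and ab: "a < b"
    and orth: "\<And>\<phi>. \<phi> \<in> test_functions {a<..<b} \<Longrightarrow> (LINT x|meas a b. cnj (g x) * \<phi> x) = 0"
  shows "AE x in meas a b. g x = 0"
proof -
  have "sqn (meas a b) g = 0"
  proof (rule ccontr)
    assume "sqn (meas a b) g \<noteq> 0"
    then have pos: "0 < sqn (meas a b) g" by (simp add: order_less_le)
    obtain \<psi> where \<psi>: "\<psi> \<in> test_functions {a<..<b}"
      "sqn (meas a b) (\<lambda>x. g x - \<psi> x) < sqn (meas a b) g"
      using test_functions_dense[OF g pos ab] .
    note sq = g test_sq_integrable[OF \<psi>(1)]
    have "complex_of_real (sqn (meas a b) g) = (LINT x|meas a b. cnj (g x) * g x)"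
      by (simp add: complex_norm_square mult.commute flip: integral_complex_of_real del: of_real_power)
    also have "\<dots> = (LINT x|meas a b. cnj (g x) * (g x - \<psi> x))"
      using orth[OF \<psi>(1)] integrable_sq_mult_cnj[OF g g] integrable_sq_mult_cnj[OF g sq(2)]
      by (simp add: right_diff_distrib)
    finally have "cmod (complex_of_real (sqn (meas a b) g)) \<le> sqrt (sqn (meas a b) g) * sqrt (sqn (meas a b) (\<lambda>x. g x - \<psi> x))"
      using Cauchy_Schwarz_inner[OF g sq_integrable_diff[OF sq]] by simp
    also have "\<dots> < sqrt (sqn (meas a b) g) * sqrt (sqn (meas a b) g)"
      using pos \<psi>(2) by (intro mult_strict_left_mono) auto
    finally show False using pos by simp
  qed
  then have "AE x in meas a b. (cmod (g x))\<^sup>2 = 0"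
    using integral_nonneg_eq_0_iff_AE[OF sq_integrable_integrable_sq[OF g]] by simp
  then show ?thesis by simp
qed

lemma integral_le_sqn:
  assumes "a < b" "f \<in> sq_integrable (meas a b)"
  shows "cmod (LINT x|meas a b. f x) \<le> sqrt (b - a) * sqrt (sqn (meas a b) f)"
  using prim_le_sqn[OF assms, of b] by (simp add: prim_end)

text \<open>
  A test function that is close to the constant one has a nonzero integral and can be normalised.
\<close>

lemma test_function_integral_one:
  assumes "a < b"
  obtains \<eta> where "\<eta> \<in> test_functions {a<..<b}" "(LINT x|meas a b. \<eta> x) = 1"
proof -
  have one: "(\<lambda>x. 1) \<in> sq_integrable (meas a b)" by (rule sq_integrable_continuous) simp
  obtain \<psi> where \<psi>: "\<psi> \<in> test_functions {a<..<b}" "sqn (meas a b) (\<lambda>x. 1 - \<psi> x) < b - a"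
    using test_functions_dense[OF one _ assms, of "b - a"] assms by auto
  have "(LINT x|meas a b. \<psi> x) \<noteq> 0"
  proof
    assume z: "(LINT x|meas a b. \<psi> x) = 0"
    have int: "integrable (meas a b) (\<lambda>x. 1 :: complex)" "integrable (meas a b) \<psi>"
      by (intro integrable_of_sq finite_meas one test_sq_integrable \<psi>)+
    have "(LINT x|meas a b. 1 - \<psi> x) = of_real (b - a)"
      using z int assms by (simp add: measure_meas scaleR_conv_of_real)
    then have "b - a \<le> sqrt (b - a) * sqrt (sqn (meas a b) (\<lambda>x. 1 - \<psi> x))"
      using integral_le_sqn[OF assms sq_integrable_diff[OF one test_sq_integrable[OF \<psi>(1)]]] assms
      by (simp del: of_real_diff)
    also have "\<dots> < sqrt (b - a) * sqrt (b - a)"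
      using \<psi>(2) assms by (intro mult_strict_left_mono) auto
    finally show False using assms by simp
  qed
  then show thesis
    using that[OF test_scale[OF \<psi>(1) assms, of "inverse (LINT x|meas a b. \<psi> x)"]] by simp
qed

text \<open>
  Subtract from a test function \<open>\<psi>\<close> near \<open>g\<close> the multiple of a fixed test function that has the same
  integral. This integral is small since that of \<open>g\<close> is zero.
\<close>

lemma test_functions_dense_mean_zero:
  assumes g: "g \<in> sq_integrable (meas a b)" and z: "(LINT x|meas a b. g x) = 0"
    and e: "0 < e" and ab: "a < b"
  obtains \<psi> where "\<psi> \<in> test_functions {a<..<b}" "(LINT x|meas a b. \<psi> x) = 0"
    "sqn (meas a b) (\<lambda>x. g x - \<psi> x) < e"
proof -
  obtain \<eta> where \<eta>: "\<eta> \<in> test_functions {a<..<b}" "(LINT x|meas a b. \<eta> x) = 1"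
    using test_function_integral_one[OF ab] .
  \<comment> \<open>The factor by which the correction enlarges the squared distance to \<open>g\<close>.\<close>
  define D where "D = 2 + 2 * (b - a) * sqn (meas a b) \<eta>"
  have D: "0 < D" using ab by (simp add: D_def add_pos_nonneg)
  obtain \<psi> where \<psi>: "\<psi> \<in> test_functions {a<..<b}" "sqn (meas a b) (\<lambda>x. g x - \<psi> x) < e / D"
    using test_functions_dense[OF g _ ab, of "e / D"] e D by auto
  define c where "c = (LINT x|meas a b. \<psi> x)"
  note sq = g test_sq_integrable[OF \<psi>(1)] test_sq_integrable[OF \<eta>(1)]
  note int = sq[THEN integrable_of_sq[OF finite_meas]]
  let ?d = "sqn (meas a b) (\<lambda>x. g x - \<psi> x)"
  have "cmod c = cmod (LINT x|meas a b. g x - \<psi> x)"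
    using z int by (simp add: c_def)
  also have "\<dots> \<le> sqrt (b - a) * sqrt ?d"
    by (rule integral_le_sqn[OF ab sq_integrable_diff[OF sq(1,2)]])
  finally have "(cmod c)\<^sup>2 \<le> (sqrt (b - a) * sqrt ?d)\<^sup>2" by (rule power_mono) simp
  then have c: "(cmod c)\<^sup>2 \<le> (b - a) * ?d" using ab by (simp add: power_mult_distrib)
  let ?\<psi> = "\<lambda>x. \<psi> x + - c * \<eta> x"
  show thesis
  proof (rule that)
    show "?\<psi> \<in> test_functions {a<..<b}" by (intro test_add test_scale \<psi> \<eta> ab)
    show "(LINT x|meas a b. ?\<psi> x) = 0" using int \<eta>(2) by (simp add: c_def)
    have "sqn (meas a b) (\<lambda>x. g x - ?\<psi> x) = sqn (meas a b) (\<lambda>x. (g x - \<psi> x) + c * \<eta> x)"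
      by (simp add: algebra_simps)
    also have "\<dots> \<le> 2 * ?d + 2 * sqn (meas a b) (\<lambda>x. c * \<eta> x)"
      by (intro sqn_add_le sq_integrable_diff sq_integrable_scale sq)
    also have "\<dots> = 2 * ?d + 2 * ((cmod c)\<^sup>2 * sqn (meas a b) \<eta>)"
      by (simp add: norm_mult power_mult_distrib)
    also have "\<dots> \<le> 2 * ?d + 2 * ((b - a) * ?d * sqn (meas a b) \<eta>)"
      by (intro add_left_mono mult_left_mono mult_right_mono c) auto
    also have "\<dots> = D * ?d" by (simp add: D_def algebra_simps)
    also have "\<dots> < e" using \<psi>(2) D by (simp add: pos_less_divide_eq mult.commute)
    finally show "sqn (meas a b) (\<lambda>x. g x - ?\<psi> x) < e" .
  qed
qed

section \<open>The weak derivative\<close>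

lemma D_adj_iff:
  assumes f: "f \<in> sq_integrable (meas a b)" and g: "g \<in> sq_integrable (meas a b)" and ab: "a < b"
  shows "(ae_class (meas a b) f, ae_class (meas a b) g) \<in> D_adj a b \<longleftrightarrow>
    (\<forall>\<phi> \<in> test_functions {a<..<b}.
       (LINT x|meas a b. cnj (f x) * vderiv \<phi> x) = (LINT x|meas a b. cnj (g x) * \<phi> x))"
proof -
  note m = sq_integrable_measurable
  have "l2_inner (meas a b) (ae_class (meas a b) f) (ae_class (meas a b) (vderiv \<phi>)) =
      (LINT x|meas a b. cnj (f x) * vderiv \<phi> x)"
    "l2_inner (meas a b) (ae_class (meas a b) g) (ae_class (meas a b) \<phi>) =
      (LINT x|meas a b. cnj (g x) * \<phi> x)"
    if "\<phi> \<in> test_functions {a<..<b}" for \<phi>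
    using f g that test_vderiv[OF that ab] by (auto intro!: l2_inner_ae_class m test_sq_integrable)
  moreover have "D_op a b = (\<lambda>\<phi>. (ae_class (meas a b) \<phi>, ae_class (meas a b) (vderiv \<phi>))) ` test_functions {a<..<b}"
    unfolding D_op_def by auto
  ultimately show ?thesis
    unfolding D_adj_def op_adjoint_def using f g by (simp add: ae_class_in_L2)
qed

lemma D_adj_L2: "(U, G) \<in> D_adj a b \<Longrightarrow> U \<in> L2 (meas a b) \<and> G \<in> L2 (meas a b)"
  by (simp add: D_adj_def op_adjoint_def)

lemma D_adj_diff:
  assumes "a < b"
    and sq: "f \<in> sq_integrable (meas a b)" "g \<in> sq_integrable (meas a b)"
      "f' \<in> sq_integrable (meas a b)" "g' \<in> sq_integrable (meas a b)"
    and D: "(ae_class (meas a b) f, ae_class (meas a b) g) \<in> D_adj a b"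
      "(ae_class (meas a b) f', ae_class (meas a b) g') \<in> D_adj a b"
  shows "(ae_class (meas a b) (\<lambda>x. f x - f' x), ae_class (meas a b) (\<lambda>x. g x - g' x)) \<in> D_adj a b"
proof -
  have "(LINT x|meas a b. cnj (f x - f' x) * vderiv \<phi> x) = (LINT x|meas a b. cnj (g x - g' x) * \<phi> x)"
    if \<phi>: "\<phi> \<in> test_functions {a<..<b}" for \<phi>
    using D \<phi> sq[THEN integrable_sq_mult_cnj[OF _ test_sq_integrable[OF \<phi>]]]
      sq[THEN integrable_sq_mult_cnj[OF _ test_sq_integrable[OF test_vderiv[OF \<phi> \<open>a < b\<close>]]]]
    by (simp add: D_adj_iff[OF sq(1,2) \<open>a < b\<close>] D_adj_iff[OF sq(3,4) \<open>a < b\<close>] left_diff_distrib)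
  then show ?thesis
    by (subst D_adj_iff) (auto intro: sq_integrable_diff sq \<open>a < b\<close>)
qed

lemma prim_cnj: "prim a b (\<lambda>x. cnj (f x)) x = cnj (prim a b f x)"
proof -
  have "prim a b (\<lambda>x. cnj (f x)) x = (LINT y|meas a b. cnj (if y < x then f y else 0))"
    unfolding prim_def by (rule Bochner_Integration.integral_cong) auto
  then show ?thesis by (simp add: prim_def)
qed

lemma sq_integrable_prim: "g \<in> sq_integrable (meas a b) \<Longrightarrow> prim a b g \<in> sq_integrable (meas a b)"
  by (intro prim_sq_integrable sq_integrable_measurable integrable_of_sq finite_meas)

lemma sq_integrable_const: "(\<lambda>x. c) \<in> sq_integrable (meas a b)"
  by (rule sq_integrable_continuous) simp

text \<open>
  Integration by parts, with the boundary terms absorbed by the compact support: exchange the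
  integrals and use \<open>\<integral>\<^sub>y\<^sup>b \<phi>' = -\<phi>(y)\<close>.
\<close>

lemma integral_prim_vderiv:
  assumes g: "g \<in> sq_integrable (meas a b)" and \<phi>: "\<phi> \<in> test_functions {a<..<b}" and ab: "a < b"
  shows "(LINT x|meas a b. cnj (prim a b g x) * vderiv \<phi> x) = - (LINT x|meas a b. cnj (g x) * \<phi> x)"
proof -
  have v: "integrable (meas a b) (vderiv \<phi>)"
    by (rule integrable_of_sq[OF finite_meas test_sq_integrable[OF test_vderiv[OF \<phi> ab]]])
  have cg: "integrable (meas a b) (\<lambda>x. cnj (g x))"
    by (rule integrable_of_sq[OF finite_meas sq_integrable_cnj[OF g]])
  have "(LINT x|meas a b. cnj (prim a b g x) * vderiv \<phi> x)
    = (LINT x|meas a b. vderiv \<phi> x * prim a b (\<lambda>y. cnj (g y)) x)"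
    by (simp add: prim_cnj mult.commute)
  also have "\<dots> = (LINT y|meas a b. tail a b (vderiv \<phi>) y * cnj (g y))"
    by (rule tail_prim_swap[OF v cg, symmetric])
  also have "\<dots> = (LINT y|meas a b. - (cnj (g y) * \<phi> y))"
    by (rule Bochner_Integration.integral_cong) (auto simp: tail_vderiv[OF \<phi> _ ab])
  finally show ?thesis by simp
qed

text \<open>
  The adjoint of the derivative is minus the weak derivative, hence the sign.
\<close>

lemma D_adj_prim:
  assumes g: "g \<in> sq_integrable (meas a b)" and ab: "a < b"
  shows "(ae_class (meas a b) (\<lambda>x. prim a b g x + c), ae_class (meas a b) (\<lambda>x. - g x)) \<in> D_adj a b"
proof (subst D_adj_iff)
  show "(\<lambda>x. prim a b g x + c) \<in> sq_integrable (meas a b)"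
    by (intro sq_integrable_add sq_integrable_prim sq_integrable_const g)
  show "\<forall>\<phi>\<in>test_functions {a<..<b}. (LINT x|meas a b. cnj (prim a b g x + c) * vderiv \<phi> x)
      = (LINT x|meas a b. cnj (- g x) * \<phi> x)"
  proof
    fix \<phi> assume \<phi>: "\<phi> \<in> test_functions {a<..<b}"
    have v: "vderiv \<phi> \<in> sq_integrable (meas a b)" by (rule test_sq_integrable[OF test_vderiv[OF \<phi> ab]])
    show "(LINT x|meas a b. cnj (prim a b g x + c) * vderiv \<phi> x) = (LINT x|meas a b. cnj (- g x) * \<phi> x)"
      using integral_prim_vderiv[OF g \<phi> ab] integral_vderiv[OF \<phi> ab]
        integrable_sq_mult_cnj[OF sq_integrable_prim[OF g] v] integrable_of_sq[OF finite_meas v]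
      by (simp add: distrib_right)
  qed
qed (intro sq_integrable_minus g ab)+

lemma D_adj_test:
  assumes "\<phi> \<in> test_functions {a<..<b}" "a < b"
  shows "(ae_class (meas a b) \<phi>, ae_class (meas a b) (\<lambda>x. - vderiv \<phi> x)) \<in> D_adj a b"
proof -
  have "ae_class (meas a b) \<phi> = ae_class (meas a b) (\<lambda>x. prim a b (vderiv \<phi>) x + 0)"
    by (rule ae_class_cong, rule AE_I2) (use prim_vderiv[OF assms(1) _ assms(2)] in auto)
  then show ?thesis
    using D_adj_prim[OF test_sq_integrable[OF test_vderiv[OF assms]] assms(2), of 0] by simp
qed

lemma D_adj_unique:
  assumes D: "(U, G) \<in> D_adj a b" "(U, H) \<in> D_adj a b" and ab: "a < b"
  shows "G = H"
proof -
  have L: "U \<in> L2 (meas a b)" "G \<in> L2 (meas a b)" "H \<in> L2 (meas a b)" using D D_adj_L2 by blast+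
  define u g h where "u = rep U" "g = rep G" "h = rep H"
  have sq: "u \<in> sq_integrable (meas a b)" "g \<in> sq_integrable (meas a b)" "h \<in> sq_integrable (meas a b)"
    and eq: "U = ae_class (meas a b) u" "G = ae_class (meas a b) g" "H = ae_class (meas a b) h"
    using L by (simp_all add: u_g_h_def L2_rep)
  have "AE x in meas a b. g x - h x = 0"
  proof (rule orthogonal_test_imp_zero[OF sq_integrable_diff[OF sq(2,3)] ab])
    fix \<phi> assume \<phi>: "\<phi> \<in> test_functions {a<..<b}"
    have "(LINT x|meas a b. cnj (g x) * \<phi> x) = (LINT x|meas a b. cnj (h x) * \<phi> x)"
      using D \<phi> unfolding eq D_adj_iff[OF sq(1,2) ab] D_adj_iff[OF sq(1,3) ab] by metis
    then show "(LINT x|meas a b. cnj (g x - h x) * \<phi> x) = 0"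
      using sq(2,3)[THEN integrable_sq_mult_cnj[OF _ test_sq_integrable[OF \<phi>]]]
      by (simp add: left_diff_distrib)
  qed
  then show ?thesis unfolding eq by (intro ae_class_cong) simp
qed

lemma op_apply_D_adj:
  assumes "(U, G) \<in> D_adj a b" "a < b"
  shows "op_apply (D_adj a b) U = G"
  unfolding op_apply_def
proof (rule the_equality)
  show "(U, G) \<in> D_adj a b" by (rule assms(1))
  show "Y = G" if "(U, Y) \<in> D_adj a b" for Y by (rule D_adj_unique[OF that assms])
qed

text \<open>
  The lemma of du Bois-Reymond. The function \<open>w = h + J k\<close> is orthogonal to the derivatives of all test
  functions, that is, to all test functions with mean value zero. Every test function \<open>\<psi>\<close> differs
  from one of those by \<open>(\<integral> \<psi>) \<eta>\<close>, with a fixed \<open>\<eta>\<close> of integral one. Therefore \<open>w\<close> minus a constant is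
  orthogonal to all test functions.
\<close>

lemma D_adj_imp_prim:
  assumes h: "h \<in> sq_integrable (meas a b)" and k: "k \<in> sq_integrable (meas a b)" and ab: "a < b"
    and D: "(ae_class (meas a b) h, ae_class (meas a b) k) \<in> D_adj a b"
  obtains c where "AE x in meas a b. h x = c - prim a b k x"
proof -
  let ?w = "\<lambda>x. h x + prim a b k x"
  have w: "?w \<in> sq_integrable (meas a b)" by (intro sq_integrable_add sq_integrable_prim h k)
  have wz: "(LINT x|meas a b. cnj (?w x) * vderiv \<phi> x) = 0" if \<phi>: "\<phi> \<in> test_functions {a<..<b}" for \<phi>
  proof -
    have v: "vderiv \<phi> \<in> sq_integrable (meas a b)" by (rule test_sq_integrable[OF test_vderiv[OF \<phi> ab]])
    have "(LINT x|meas a b. cnj (h x) * vderiv \<phi> x) = (LINT x|meas a b. cnj (k x) * \<phi> x)"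
      using D \<phi> by (simp add: D_adj_iff[OF h k ab])
    then show ?thesis
      using integral_prim_vderiv[OF k \<phi> ab] integrable_sq_mult_cnj[OF h v]
        integrable_sq_mult_cnj[OF sq_integrable_prim[OF k] v]
      by (simp add: distrib_right)
  qed
  obtain \<eta> where \<eta>: "\<eta> \<in> test_functions {a<..<b}" "(LINT x|meas a b. \<eta> x) = 1"
    using test_function_integral_one[OF ab] .
  \<comment> \<open>The only constant for which \<open>w - c\<close> is orthogonal to \<open>\<eta>\<close>.\<close>
  define c where "c = cnj (LINT x|meas a b. cnj (?w x) * \<eta> x)"
  have "AE x in meas a b. ?w x - c = 0"
  proof (rule orthogonal_test_imp_zero[OF sq_integrable_diff[OF w sq_integrable_const] ab])
    fix \<psi> assume \<psi>: "\<psi> \<in> test_functions {a<..<b}"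
    define m where "m = (LINT x|meas a b. \<psi> x)"
    let ?\<psi> = "\<lambda>x. \<psi> x + - m * \<eta> x"
    note sq = test_sq_integrable[OF \<psi>] test_sq_integrable[OF \<eta>(1)]
    note int = sq[THEN integrable_of_sq[OF finite_meas]]
    have t: "?\<psi> \<in> test_functions {a<..<b}" by (intro test_add test_scale \<psi> \<eta> ab)
    have z: "(LINT x|meas a b. ?\<psi> x) = 0" using int \<eta>(2) by (simp add: m_def)
    have "0 = (LINT x|meas a b. cnj (?w x) * ?\<psi> x)"
      using wz[OF antiderivative_test(1)[OF t ab z]] unfolding antiderivative_test(2)[OF t ab z] by simp
    also have "\<dots> = (LINT x|meas a b. cnj (?w x) * \<psi> x + - m * (cnj (?w x) * \<eta> x))"
      by (simp add: algebra_simps)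
    also have "\<dots> = (LINT x|meas a b. cnj (?w x) * \<psi> x) + - m * (LINT x|meas a b. cnj (?w x) * \<eta> x)"
      using sq[THEN integrable_sq_mult_cnj[OF w]] by (subst Bochner_Integration.integral_add) auto
    finally have e: "(LINT x|meas a b. cnj (?w x) * \<psi> x) = cnj c * m" by (simp add: c_def)
    have "(LINT x|meas a b. cnj (?w x - c) * \<psi> x) = (LINT x|meas a b. cnj (?w x) * \<psi> x - cnj c * \<psi> x)"
      by (simp add: algebra_simps)
    also have "\<dots> = (LINT x|meas a b. cnj (?w x) * \<psi> x) - cnj c * m"
      using int sq[THEN integrable_sq_mult_cnj[OF w]] by (subst Bochner_Integration.integral_diff) (auto simp: m_def)
    finally show "(LINT x|meas a b. cnj (?w x - c) * \<psi> x) = 0" using e by simp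
  qed
  then have "AE x in meas a b. h x = c - prim a b k x"
    by eventually_elim (simp add: algebra_simps add_eq_0_iff)
  with that show thesis by blast
qed

lemma sqn_prim_sq_le:
  assumes "a < b" "g \<in> sq_integrable (meas a b)"
  shows "sqn (meas a b) (prim a b g) \<le> (b - a)\<^sup>2 * sqn (meas a b) g"
proof -
  have "(sqrt (sqn (meas a b) (prim a b g)))\<^sup>2 \<le> ((b - a) * sqrt (sqn (meas a b) g))\<^sup>2"
    by (intro power_mono sqn_prim_le[OF assms]) simp
  then show ?thesis by (simp add: power_mult_distrib)
qed

text \<open>
  Approximate \<open>g\<close> in \<open>L\<^sup>2\<close> by test functions with mean value zero. Their primitives are test functions, and
  they approximate \<open>J g\<close> together with the derivatives because \<open>J\<close> is bounded.
\<close>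

lemma prim_in_W1_0:
  assumes g: "g \<in> sq_integrable (meas a b)" and z: "(LINT x|meas a b. g x) = 0" and ab: "a < b"
  shows "ae_class (meas a b) (prim a b g) \<in> W1_0 a b"
  unfolding W1_0_def
proof (intro CollectI conjI allI impI)
  have D: "(ae_class (meas a b) (prim a b g), ae_class (meas a b) (\<lambda>x. - g x)) \<in> D_adj a b"
    if "g \<in> sq_integrable (meas a b)" for g
    using D_adj_prim[OF that ab, of 0] by simp
  then show "ae_class (meas a b) (prim a b g) \<in> W1 a b"
    using g unfolding W1_def by blast
  fix e :: real assume e: "0 < e"
  \<comment> \<open>The \<open>W\<^sup>1\<close>-norm of \<open>J r\<close> is at most \<open>E\<^sup>1\<^sup>/\<^sup>2\<close> times the \<open>L\<^sup>2\<close>-norm of \<open>r\<close>.\<close>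
  define E where "E = (b - a)\<^sup>2 + 1"
  have E: "0 < E" by (simp add: E_def add_nonneg_pos)
  obtain \<psi> where \<psi>: "\<psi> \<in> test_functions {a<..<b}" "(LINT x|meas a b. \<psi> x) = 0"
    "sqn (meas a b) (\<lambda>x. g x - \<psi> x) < e\<^sup>2 / E"
    using test_functions_dense_mean_zero[OF g z _ ab, of "e\<^sup>2 / E"] e E by auto
  note sq = g test_sq_integrable[OF \<psi>(1)]
  let ?r = "\<lambda>x. g x - \<psi> x"
  let ?X = "ae_class (meas a b) (prim a b ?r)"
  have r: "?r \<in> sq_integrable (meas a b)" by (intro sq_integrable_diff sq)
  note m = sq_integrable_measurable
  have "l2_diff (meas a b) (ae_class (meas a b) (prim a b g)) (ae_class (meas a b) (prim a b \<psi>)) = ?X"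
    using sq integrable_of_sq[OF finite_meas sq(1)] integrable_of_sq[OF finite_meas sq(2)]
    by (subst l2_diff_ae_class) (auto intro!: m sq_integrable_prim ae_class_cong AE_I2 simp: prim_diff)
  moreover have "W1_norm a b ?X < e"
  proof -
    have 1: "l2_norm (meas a b) ?X = sqrt (sqn (meas a b) (prim a b ?r))"
      by (intro l2_norm_ae_class m sq_integrable_prim r)
    have 2: "l2_norm (meas a b) (op_apply (D_adj a b) ?X) = sqrt (sqn (meas a b) ?r)"
      unfolding op_apply_D_adj[OF D[OF r] ab]
      by (simp only: l2_norm_ae_class[OF m[OF sq_integrable_minus[OF r]]] norm_minus_cancel)
    have "(l2_norm (meas a b) ?X)\<^sup>2 + (l2_norm (meas a b) (op_apply (D_adj a b) ?X))\<^sup>2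
      \<le> E * sqn (meas a b) ?r"
      unfolding 1 2 using sqn_prim_sq_le[OF ab r] by (simp add: E_def distrib_right)
    also have "\<dots> < e\<^sup>2" using \<psi>(3) E by (simp add: pos_less_divide_eq mult.commute)
    finally have "sqrt ((l2_norm (meas a b) ?X)\<^sup>2 + (l2_norm (meas a b) (op_apply (D_adj a b) ?X))\<^sup>2)
      < sqrt (e\<^sup>2)"
      by (rule real_sqrt_less_mono)
    then show ?thesis unfolding W1_norm_def using e by simp
  qed
  ultimately show "\<exists>\<phi>\<in>test_functions {a<..<b}.
      W1_norm a b (l2_diff (meas a b) (ae_class (meas a b) (prim a b g)) (ae_class (meas a b) \<phi>)) < e"
    by (intro bexI[of _ "prim a b \<psi>"]) (simp_all add: antiderivative_test(1)[OF \<psi>(1) ab \<psi>(2)])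
qed

lemma nonneg_le_eps_imp_zero:
  assumes "\<And>e. 0 < e \<Longrightarrow> x \<le> C * e" "0 \<le> (x::real)"
  shows "x = 0"
proof (rule ccontr)
  assume "x \<noteq> 0"
  then have x: "0 < x" using assms by simp
  have "x \<le> C * (x / (2 * (\<bar>C\<bar> + 1)))" by (rule assms(1)) (use x in auto)
  also have "\<dots> \<le> \<bar>C\<bar> * (x / (2 * (\<bar>C\<bar> + 1)))" by (intro mult_right_mono) (use x in auto)
  also have "\<dots> < x" using x by (auto simp: divide_less_eq intro!: mult_strict_left_mono)
  finally show False by simp
qed

text \<open>
  Test functions satisfy \<open>\<phi> = J \<phi>'\<close> and \<open>\<integral> \<phi>' = 0\<close>. Both identities are continuous in the \<open>W\<^sup>1\<close>-norm and so
  pass to the closure. This is where the boundary values at both ends enter.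
\<close>

lemma W1_0_imp_prim:
  assumes u: "u \<in> sq_integrable (meas a b)" and g: "g \<in> sq_integrable (meas a b)" and ab: "a < b"
    and D: "(ae_class (meas a b) u, ae_class (meas a b) g) \<in> D_adj a b"
    and W: "ae_class (meas a b) u \<in> W1_0 a b"
  shows "AE x in meas a b. u x = - prim a b g x" "(LINT x|meas a b. g x) = 0"
proof -
  note m = sq_integrable_measurable
  have approx: "\<exists>\<phi> \<in> test_functions {a<..<b}. sqn (meas a b) (\<lambda>x. u x - \<phi> x) \<le> e \<and>
      sqn (meas a b) (\<lambda>x. g x + vderiv \<phi> x) \<le> e" if e: "0 < e" for e
  proof -
    obtain \<phi> where \<phi>: "\<phi> \<in> test_functions {a<..<b}"
      "W1_norm a b (l2_diff (meas a b) (ae_class (meas a b) u) (ae_class (meas a b) \<phi>)) < sqrt e"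
      using W e unfolding W1_0_def by (auto dest!: spec[of _ "sqrt e"])
    note \<phi>sq = test_sq_integrable[OF \<phi>(1)]
    have vsq: "vderiv \<phi> \<in> sq_integrable (meas a b)"
      by (rule test_sq_integrable[OF test_vderiv[OF \<phi>(1) ab]])
    let ?X = "ae_class (meas a b) (\<lambda>x. u x - \<phi> x)"
    have X: "l2_diff (meas a b) (ae_class (meas a b) u) (ae_class (meas a b) \<phi>) = ?X"
      by (intro l2_diff_ae_class m u \<phi>sq)
    have "(?X, ae_class (meas a b) (\<lambda>x. g x - - vderiv \<phi> x)) \<in> D_adj a b"
      by (rule D_adj_diff[OF ab u g \<phi>sq sq_integrable_minus[OF vsq] D D_adj_test[OF \<phi>(1) ab]])
    from op_apply_D_adj[OF this ab]
    have op: "op_apply (D_adj a b) ?X = ae_class (meas a b) (\<lambda>x. g x + vderiv \<phi> x)" by simp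
    have "l2_norm (meas a b) ?X = sqrt (sqn (meas a b) (\<lambda>x. u x - \<phi> x))"
      by (intro l2_norm_ae_class m sq_integrable_diff u \<phi>sq)
    moreover have "l2_norm (meas a b) (op_apply (D_adj a b) ?X)
        = sqrt (sqn (meas a b) (\<lambda>x. g x + vderiv \<phi> x))"
      unfolding op by (intro l2_norm_ae_class m sq_integrable_add g vsq)
    ultimately have "sqn (meas a b) (\<lambda>x. u x - \<phi> x) + sqn (meas a b) (\<lambda>x. g x + vderiv \<phi> x) < e"
      using \<phi>(2) unfolding X W1_norm_def by simp
    moreover have "0 \<le> sqn (meas a b) (\<lambda>x. u x - \<phi> x)" "0 \<le> sqn (meas a b) (\<lambda>x. g x + vderiv \<phi> x)"
      by simp_all
    ultimately show ?thesis using \<phi>(1) by (intro bexI[of _ \<phi>]) linarith+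
  qed
  have upg: "(\<lambda>x. u x + prim a b g x) \<in> sq_integrable (meas a b)"
    by (intro sq_integrable_add sq_integrable_prim u g)
  have "sqn (meas a b) (\<lambda>x. u x + prim a b g x) = 0"
  proof (rule nonneg_le_eps_imp_zero)
    fix e :: real assume "0 < e"
    with approx obtain \<phi> where \<phi>: "\<phi> \<in> test_functions {a<..<b}"
      and s1: "sqn (meas a b) (\<lambda>x. u x - \<phi> x) \<le> e" and s2: "sqn (meas a b) (\<lambda>x. g x + vderiv \<phi> x) \<le> e"
      by blast
    note \<phi>sq = test_sq_integrable[OF \<phi>]
    have vsq: "vderiv \<phi> \<in> sq_integrable (meas a b)"
      by (rule test_sq_integrable[OF test_vderiv[OF \<phi> ab]])
    let ?r = "\<lambda>x. g x + vderiv \<phi> x"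
    have r: "?r \<in> sq_integrable (meas a b)" by (intro sq_integrable_add g vsq)
    have pr: "prim a b ?r x = prim a b g x + \<phi> x" if "x \<in> {a<..<b}" for x
      using that prim_vderiv[OF \<phi> _ ab, of x] 
        prim_add[OF integrable_of_sq[OF finite_meas g] integrable_of_sq[OF finite_meas vsq]] by simp
    have "sqn (meas a b) (\<lambda>x. u x + prim a b g x) = sqn (meas a b) (\<lambda>x. (u x - \<phi> x) + prim a b ?r x)"
      by (rule Bochner_Integration.integral_cong) (auto simp: pr)
    also have "\<dots> \<le> 2 * sqn (meas a b) (\<lambda>x. u x - \<phi> x) + 2 * sqn (meas a b) (prim a b ?r)"
      by (intro sqn_add_le sq_integrable_diff sq_integrable_prim u \<phi>sq r)
    also have "sqn (meas a b) (prim a b ?r) \<le> (b - a)\<^sup>2 * sqn (meas a b) ?r"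
      by (rule sqn_prim_sq_le[OF ab r])
    also have "(b - a)\<^sup>2 * sqn (meas a b) ?r \<le> (b - a)\<^sup>2 * e"
      by (intro mult_left_mono s2) simp
    also have "2 * sqn (meas a b) (\<lambda>x. u x - \<phi> x) \<le> 2 * e" using s1 by simp
    finally show "sqn (meas a b) (\<lambda>x. u x + prim a b g x) \<le> (2 + 2 * (b - a)\<^sup>2) * e"
      by (simp add: algebra_simps)
  qed simp
  then have "AE x in meas a b. (cmod (u x + prim a b g x))\<^sup>2 = 0"
    using integral_nonneg_eq_0_iff_AE[OF sq_integrable_integrable_sq[OF upg]] by simp
  then show "AE x in meas a b. u x = - prim a b g x"
    by eventually_elim (simp add: add_eq_0_iff2)
  have "(cmod (LINT x|meas a b. g x))\<^sup>2 = 0"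
  proof (rule nonneg_le_eps_imp_zero)
    fix e :: real assume "0 < e"
    with approx obtain \<phi> where \<phi>: "\<phi> \<in> test_functions {a<..<b}"
      and s2: "sqn (meas a b) (\<lambda>x. g x + vderiv \<phi> x) \<le> e"
      by blast
    have vsq: "vderiv \<phi> \<in> sq_integrable (meas a b)"
      by (rule test_sq_integrable[OF test_vderiv[OF \<phi> ab]])
    have "(LINT x|meas a b. g x) = (LINT x|meas a b. g x + vderiv \<phi> x)"
      using integral_vderiv[OF \<phi> ab] integrable_of_sq[OF finite_meas g] integrable_of_sq[OF finite_meas vsq]
      by simp
    then have "cmod (LINT x|meas a b. g x) \<le> sqrt (b - a) * sqrt (sqn (meas a b) (\<lambda>x. g x + vderiv \<phi> x))"
      using integral_le_sqn[OF ab sq_integrable_add[OF g vsq]] by simp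
    then have "(cmod (LINT x|meas a b. g x))\<^sup>2 \<le> (sqrt (b - a) * sqrt (sqn (meas a b) (\<lambda>x. g x + vderiv \<phi> x)))\<^sup>2"
      by (rule power_mono) simp
    also have "\<dots> = (b - a) * sqn (meas a b) (\<lambda>x. g x + vderiv \<phi> x)"
      using ab by (simp add: power_mult_distrib)
    also have "\<dots> \<le> (b - a) * e" using s2 ab by (intro mult_left_mono) auto
    finally show "(cmod (LINT x|meas a b. g x))\<^sup>2 \<le> (b - a) * e" .
  qed simp
  then show "(LINT x|meas a b. g x) = 0" by simp
qed

section \<open>Solution of the boundary value problem\<close>

lemma integrable_Linf:
  assumes "p \<in> Linf (meas a b)"
  shows "integrable (meas a b) p"
proof -
  interpret finite_measure "meas a b" by (rule finite_meas)
  from assms obtain K where "AE x in meas a b. \<bar>p x\<bar> \<le> K" "p \<in> borel_measurable (meas a b)"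
    by (auto simp: Linf_def)
  then show ?thesis by (intro integrable_const_bound[where B=K]) auto
qed

lemma L1_norm_pos:
  assumes "integrable (meas a b) p" "\<not> (AE x in meas a b. p x = 0)"
  shows "0 < L1_norm (meas a b) p"
proof -
  have "L1_norm (meas a b) p \<noteq> 0"
    using assms integral_nonneg_eq_0_iff_AE[of "meas a b" "\<lambda>x. \<bar>p x\<bar>"]
    by (simp add: L1_norm_def)
  then show ?thesis by (simp add: order_less_le)
qed

lemma coeffs_L_properties:
  assumes "p \<in> coeffs_L a b" "a < b"
  shows "integrable (meas a b) p" "AE x in meas a b. 0 < p x" "0 < L1_norm (meas a b) p"
    "L1_norm (meas a b) p = (LINT x|meas a b. p x)"
    "\<exists>K. AE x in meas a b. \<bar>p x\<bar> \<le> K"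
proof -
  from assms(1) obtain C1 C2 where C: "0 < C1" "AE x in meas a b. C1 \<le> p x \<and> p x \<le> C2"
    and L: "p \<in> Linf (meas a b)" by (auto simp: coeffs_L_def)
  show int: "integrable (meas a b) p" by (rule integrable_Linf[OF L])
  show pos: "AE x in meas a b. 0 < p x"
    using C(2) by eventually_elim (use C(1) in linarith)
  show "\<exists>K. AE x in meas a b. \<bar>p x\<bar> \<le> K" using L by (auto simp: Linf_def)
  have "\<not> (AE x in meas a b. p x = 0)"
  proof
    assume "AE x in meas a b. p x = 0"
    with pos have "AE x in meas a b. False" by eventually_elim simp
    then have "emeasure (meas a b) (space (meas a b)) = 0"
      by (simp only: trivial_limit_def[symmetric] ae_filter_eq_bot_iff)
    then have "measure (meas a b) {a<..<b} = 0" by (simp add: measure_def)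
    then show False using measure_meas[OF assms(2)] assms(2) by simp
  qed
  then show "0 < L1_norm (meas a b) p" by (rule L1_norm_pos[OF int])
  show "L1_norm (meas a b) p = (LINT x|meas a b. p x)"
    unfolding L1_norm_def
    by (rule integral_cong_AE) (use int pos in \<open>auto elim: eventually_mono\<close>)
qed

lemma flux_sq_integrable:
  assumes "f \<in> sq_integrable (meas a b)"
  shows "flux a b p f \<in> sq_integrable (meas a b)"
  unfolding flux_def by (intro sq_integrable_diff sq_integrable_const sq_integrable_prim assms)

lemma flux_const_add:
  assumes "integrable (meas a b) p" "integrable (meas a b) f" "integrable (meas a b) g"
  shows "flux_const a b p (\<lambda>y. f y + g y) = flux_const a b p f + flux_const a b p g"
proof -
  have pc: "integrable (meas a b) (\<lambda>y. complex_of_real (p y))" using assms(1) by simp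
  show ?thesis
    unfolding flux_const_def prim_add[OF assms(2,3)]
    using prim_bounded_mult[OF pc assms(2)] prim_bounded_mult[OF pc assms(3)]
    by (simp add: distrib_left add_divide_distrib)
qed

lemma flux_const_scale: "flux_const a b p (\<lambda>y. c * f y) = c * flux_const a b p f"
proof -
  have "(LINT x|meas a b. of_real (p x) * (c * prim a b f x))
      = (LINT x|meas a b. c * (of_real (p x) * prim a b f x))"
    by (simp add: mult_ac)
  then show ?thesis by (simp add: flux_const_def prim_scale)
qed

lemma flux_add:
  assumes "integrable (meas a b) p" "integrable (meas a b) f" "integrable (meas a b) g"
  shows "flux a b p (\<lambda>y. f y + g y) x = flux a b p f x + flux a b p g x"
  by (simp add: flux_def flux_const_add[OF assms] prim_add[OF assms(2,3)])

lemma flux_scale: "flux a b p (\<lambda>y. c * f y) x = c * flux a b p f x"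
  by (simp add: flux_def flux_const_scale prim_scale right_diff_distrib)

lemma flux_cong_AE:
  assumes "f \<in> sq_integrable (meas a b)" "g \<in> sq_integrable (meas a b)" "AE x in meas a b. f x = g x"
  shows "flux a b p f = flux a b p g"
  using prim_cong_AE[OF assms(1,2)[THEN sq_integrable_measurable] assms(3)]
  by (auto simp: flux_def flux_const_def)

lemma flux_bounded_map:
  assumes ab: "a < b" and p: "integrable (meas a b) p"
  shows "l2_bounded_map (meas a b) (2 * (b - a)) (flux a b p)"
proof -
  have "sqrt (sqn (meas a b) (flux a b p f)) \<le> 2 * (b - a) * sqrt (sqn (meas a b) f)"
    if f: "f \<in> sq_integrable (meas a b)" for f
  proof -
    have "sqrt (sqn (meas a b) (flux a b p f))
      \<le> sqrt (measure (meas a b) (space (meas a b))) * (2 * (sqrt (b - a) * sqrt (sqn (meas a b) f)))"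
      by (rule sqn_le_of_bound[OF finite_meas flux_le[OF ab f p]]) (use ab in simp)
    also have "\<dots> = 2 * (sqrt (b - a) * sqrt (b - a)) * sqrt (sqn (meas a b) f)"
      by (simp only: space_lebesgue_on measure_meas[OF ab] mult_ac)
    finally show ?thesis using ab by simp
  qed
  moreover have "flux a b p f x = flux a b p g x"
    if "f \<in> sq_integrable (meas a b)" "g \<in> sq_integrable (meas a b)" "AE x in meas a b. f x = g x" for f g x
    by (simp add: flux_cong_AE[OF that])
  moreover note flux_add[OF p integrable_of_sq[OF finite_meas] integrable_of_sq[OF finite_meas]]
  ultimately show ?thesis
    unfolding l2_bounded_map_def
    by (intro ballI conjI impI allI AE_I2 flux_sq_integrable flux_scale) blast+
qed

lemma potential_bounded_map:
  assumes ab: "a < b" and p: "integrable (meas a b) p"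
  shows "l2_bounded_map (meas a b) (2 * (b - a) * L1_norm (meas a b) p) (potential a b p)"
proof -
  have int: "integrable (meas a b) (\<lambda>y. of_real (p y) * flux a b p f y)" if "f \<in> sq_integrable (meas a b)" for f
    by (rule integrable_mult_flux[OF p integrable_of_sq[OF finite_meas that]])
  have bnd: "cmod (potential a b p f x) \<le> L1_norm (meas a b) p * (2 * (sqrt (b - a) * sqrt (sqn (meas a b) f)))"
    if f: "f \<in> sq_integrable (meas a b)" for f x
  proof -
    let ?K = "2 * (sqrt (b - a) * sqrt (sqn (meas a b) f))"
    have "cmod (potential a b p f x) \<le> (LINT y|meas a b. cmod (of_real (p y) * flux a b p f y))"
      unfolding potential_def by (rule prim_bound[OF int[OF f]])
    also have "\<dots> \<le> (LINT y|meas a b. \<bar>p y\<bar> * ?K)"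
    proof (rule integral_mono)
      show "cmod (of_real (p y) * flux a b p f y) \<le> \<bar>p y\<bar> * ?K" for y
        using flux_le[OF ab f p, of y] by (simp add: norm_mult mult_left_mono)
    qed (use p int[OF f] in auto)
    also have "\<dots> = L1_norm (meas a b) p * ?K" by (simp add: L1_norm_def)
    finally show ?thesis .
  qed
  have sq: "potential a b p f \<in> sq_integrable (meas a b)" if f: "f \<in> sq_integrable (meas a b)" for f
    unfolding potential_def
    by (rule prim_sq_integrable[OF borel_measurable_integrable[OF int[OF f]] int[OF f]])
  have "sqrt (sqn (meas a b) (potential a b p f)) \<le> 2 * (b - a) * L1_norm (meas a b) p * sqrt (sqn (meas a b) f)"
    if f: "f \<in> sq_integrable (meas a b)" for f
  proof -
    have "sqrt (sqn (meas a b) (potential a b p f)) \<le> sqrt (measure (meas a b) (space (meas a b)))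
      * (L1_norm (meas a b) p * (2 * (sqrt (b - a) * sqrt (sqn (meas a b) f))))"
      by (rule sqn_le_of_bound[OF finite_meas bnd[OF f]]) (use ab in simp)
    also have "\<dots> = 2 * (sqrt (b - a) * sqrt (b - a)) * L1_norm (meas a b) p * sqrt (sqn (meas a b) f)"
      by (simp only: space_lebesgue_on measure_meas[OF ab] mult_ac)
    finally show ?thesis using ab by simp
  qed
  moreover have "potential a b p (\<lambda>y. f y + g y) x = potential a b p f x + potential a b p g x"
    if "f \<in> sq_integrable (meas a b)" "g \<in> sq_integrable (meas a b)" for f g x
    unfolding potential_def flux_add[OF p that[THEN integrable_of_sq[OF finite_meas]]] distrib_left
    by (rule prim_add[OF that[THEN int]])
  moreover have "potential a b p (\<lambda>y. c * f y) x = c * potential a b p f x" for c f x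
    unfolding potential_def flux_scale by (simp add: mult.left_commute[of _ c] prim_scale)
  moreover have "potential a b p f x = potential a b p g x"
    if "f \<in> sq_integrable (meas a b)" "g \<in> sq_integrable (meas a b)" "AE x in meas a b. f x = g x" for f g x
    by (simp add: potential_def flux_cong_AE[OF that])
  ultimately show ?thesis
    unfolding l2_bounded_map_def by (intro ballI conjI impI allI AE_I2 sq) blast+
qed

lemma B_op_eq:
  assumes "integrable (meas a b) p"
  shows "B_op a b p = induced_op (meas a b) (potential a b p)"
proof -
  have "ae_class (meas a b) (B_fun a b p f) = ae_class (meas a b) (potential a b p f)"
    if "f \<in> sq_integrable (meas a b)" for f
    by (rule ae_class_cong, rule AE_I2, rule B_fun_eq_potential[OF assms integrable_of_sq[OF finite_meas that]])
       simp
  then show ?thesis unfolding B_op_def induced_op_def by force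
qed

lemma C_op_eq:
  assumes "integrable (meas a b) p"
  shows "C_op a b p = induced_op (meas a b) (flux a b p)"
proof -
  have "ae_class (meas a b) (C_fun a b p f) = ae_class (meas a b) (flux a b p f)"
    if "f \<in> sq_integrable (meas a b)" for f
    by (rule ae_class_cong, rule AE_I2, rule C_fun_eq_flux[OF assms integrable_of_sq[OF finite_meas that]])
       simp
  then show ?thesis unfolding C_op_def induced_op_def by force
qed

lemma mult_sq_integrable:
  assumes "p \<in> coeffs_L a b" "a < b" "h \<in> sq_integrable (meas a b)"
  shows "(\<lambda>x. of_real (p x) * h x) \<in> sq_integrable (meas a b)"
proof -
  from coeffs_L_properties(5)[OF assms(1,2)] obtain K where K: "AE x in meas a b. \<bar>p x\<bar> \<le> K" by blast
  have [measurable]: "p \<in> borel_measurable (meas a b)" using coeffs_L_properties(1)[OF assms(1,2)] by simp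
  show ?thesis
    by (rule sq_integrable_bounded_mult[OF assms(3), where K=K]) (use K in auto)
qed

text \<open>
  The constant in the flux is chosen so that \<open>p \<cdot> flux\<close> has mean value zero, which puts its primitive into
  \<open>W\<^sup>1\<^sub>0\<close>. The rest is two applications of the rule for the weak derivative of a primitive.
\<close>

lemma solution_in_A_op:
  assumes p: "p \<in> coeffs_L a b" and ab: "a < b" and f: "f \<in> sq_integrable (meas a b)"
  defines "U \<equiv> ae_class (meas a b) (potential a b p f)"
    and "G \<equiv> ae_class (meas a b) (\<lambda>x. - (of_real (p x) * flux a b p f x))"
    and "H \<equiv> ae_class (meas a b) (\<lambda>x. - flux a b p f x)"
  shows "(U, ae_class (meas a b) f) \<in> A_op a b p" "(U, G) \<in> D_adj a b"
    "(G, H) \<in> op_mult (meas a b) (\<lambda>x. 1 / p x)"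
proof -
  note facts = coeffs_L_properties[OF p ab]
  have intf: "integrable (meas a b) f" by (rule integrable_of_sq[OF finite_meas f])
  have pc: "integrable (meas a b) (\<lambda>x. complex_of_real (p x))" using facts(1) by simp
  have fl: "flux a b p f \<in> sq_integrable (meas a b)" by (rule flux_sq_integrable[OF f])
  let ?g = "\<lambda>x. of_real (p x) * flux a b p f x"
  have g: "?g \<in> sq_integrable (meas a b)" by (rule mult_sq_integrable[OF p ab fl])
  show UG: "(U, G) \<in> D_adj a b"
    using D_adj_prim[OF g ab, of 0] by (simp add: U_def G_def potential_def)
  have "(LINT x|meas a b. ?g x) = (LINT x|meas a b. flux_const a b p f * of_real (p x) - of_real (p x) * prim a b f x)"
    by (simp add: flux_def algebra_simps)
  also have "\<dots> = flux_const a b p f * of_real (L1_norm (meas a b) p) - (LINT x|meas a b. of_real (p x) * prim a b f x)"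
    using pc prim_bounded_mult[OF pc intf] by (simp add: facts(4))
  also have "\<dots> = 0" using facts(3) by (simp add: flux_const_def)
  finally have "U \<in> W1_0 a b"
    unfolding U_def potential_def by (rule prim_in_W1_0[OF g _ ab])
  have ng: "(\<lambda>x. - ?g x) \<in> borel_measurable (meas a b)"
    by (rule sq_integrable_measurable[OF sq_integrable_minus[OF g]])
  have "H = ae_class (meas a b) (\<lambda>x. of_real (1 / p x) * rep G x)"
    unfolding H_def G_def
  proof (rule ae_class_cong)
    show "AE x in meas a b. - flux a b p f x
        = of_real (1 / p x) * rep (ae_class (meas a b) (\<lambda>x. - ?g x)) x"
      using rep_ae_class(2)[OF ng] facts(2) by eventually_elim simp
  qed
  moreover have "G \<in> L2 (meas a b)" "H \<in> L2 (meas a b)"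
    by (simp_all add: G_def H_def ae_class_in_L2 sq_integrable_minus g fl)
  ultimately show GH: "(G, H) \<in> op_mult (meas a b) (\<lambda>x. 1 / p x)"
    unfolding op_mult_def by blast
  have "(H, ae_class (meas a b) (\<lambda>x. - f x)) \<in> D_adj a b"
    using D_adj_prim[OF f ab, of "- flux_const a b p f"] by (simp add: H_def flux_def)
  moreover have "ae_class (meas a b) f = l2_scale (meas a b) (- 1) (ae_class (meas a b) (\<lambda>x. - f x))"
    by (subst l2_scale_ae_class) (auto intro: sq_integrable_measurable sq_integrable_minus f)
  ultimately show "(U, ae_class (meas a b) f) \<in> A_op a b p"
    unfolding A_op_def op_uminus_def using UG GH \<open>U \<in> W1_0 a b\<close> by blast
qed

text \<open>
  Conversely, let \<open>u\<close> be in the domain. By the lemma of du Bois-Reymond \<open>-(1/p) u' = c + J f\<close> with an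
  unknown constant \<open>c\<close>. Membership of \<open>u\<close> in \<open>W\<^sup>1\<^sub>0\<close> says that \<open>u'\<close> has mean value zero, which
  determines \<open>c\<close>, and that \<open>u\<close> is the primitive of \<open>u'\<close>.
\<close>

lemma A_op_imp_solution:
  assumes p: "p \<in> coeffs_L a b" and ab: "a < b" and A: "(U, V) \<in> A_op a b p"
  obtains f where "f \<in> sq_integrable (meas a b)" "V = ae_class (meas a b) f"
    "U = ae_class (meas a b) (potential a b p f)"
proof -
  note facts = coeffs_L_properties[OF p ab]
  note m = sq_integrable_measurable
  from A obtain G H K where D1: "(U, G) \<in> D_adj a b" and GH: "(G, H) \<in> op_mult (meas a b) (\<lambda>x. 1 / p x)"
    and D2: "(H, K) \<in> D_adj a b" and V: "V = l2_scale (meas a b) (-1) K" and W: "U \<in> W1_0 a b"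
    unfolding A_op_def op_uminus_def by blast
  define u g h k where "u = rep U" "g = rep G" "h = rep H" "k = rep K"
  have sq: "u \<in> sq_integrable (meas a b)" "g \<in> sq_integrable (meas a b)"
      "h \<in> sq_integrable (meas a b)" "k \<in> sq_integrable (meas a b)"
    and eq: "U = ae_class (meas a b) u" "G = ae_class (meas a b) g"
      "H = ae_class (meas a b) h" "K = ae_class (meas a b) k"
    using D_adj_L2[OF D1] D_adj_L2[OF D2] by (simp_all add: u_g_h_k_def L2_rep)
  let ?f = "\<lambda>x. - k x"
  have f: "?f \<in> sq_integrable (meas a b)" by (rule sq_integrable_minus[OF sq(4)])
  have intf: "integrable (meas a b) ?f" by (rule integrable_of_sq[OF finite_meas f])
  have pc: "integrable (meas a b) (\<lambda>x. complex_of_real (p x))" using facts(1) by simp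
  have Vf: "V = ae_class (meas a b) ?f"
    unfolding V eq using l2_scale_ae_class[OF m[OF sq(4)], of "-1"] by simp
  obtain c where c: "AE x in meas a b. h x = c - prim a b k x"
    using D_adj_imp_prim[OF sq(3,4) ab] D2 unfolding eq by blast
  have pk: "prim a b ?f x = - prim a b k x" for x
    using prim_scale[of a b "-1" k x] by simp
  have "ae_class (meas a b) h = ae_class (meas a b) (\<lambda>x. of_real (1 / p x) * g x)"
    using GH by (simp add: op_mult_def eq(3)[symmetric] u_g_h_k_def(2))
  then have "AE x in meas a b. h x = of_real (1 / p x) * g x"
    by (simp only: ae_class_eq_iff[OF m[OF sq(3)]])
  with c facts(2) have gx: "AE x in meas a b. g x = of_real (p x) * (c + prim a b ?f x)"
    by eventually_elim (auto simp: pk field_simps)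
  have W': "ae_class (meas a b) u \<in> W1_0 a b" "(ae_class (meas a b) u, ae_class (meas a b) g) \<in> D_adj a b"
    using W D1 by (simp_all only: eq)
  note u = W1_0_imp_prim[OF sq(1,2) ab W'(2,1)]
  have meas2: "(\<lambda>x. of_real (p x) * (c + prim a b ?f x)) \<in> borel_measurable (meas a b)"
    using pc prim_measurable[OF m[OF f]] by measurable
  have "0 = (LINT x|meas a b. of_real (p x) * (c + prim a b ?f x))"
    using u(2) integral_cong_AE[OF m[OF sq(2)] meas2 gx] by simp
  also have "\<dots> = (LINT x|meas a b. c * of_real (p x) + of_real (p x) * prim a b ?f x)"
    by (simp only: distrib_left mult.commute)
  also have "\<dots> = c * of_real (L1_norm (meas a b) p) + (LINT x|meas a b. of_real (p x) * prim a b ?f x)"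
    using pc prim_bounded_mult[OF pc intf] by (simp add: facts(4))
  finally have "c = - flux_const a b p ?f"
    using facts(3) by (simp add: flux_const_def field_simps add_eq_0_iff)
  then have "AE x in meas a b. g x = - (of_real (p x) * flux a b p ?f x)"
    using gx by (simp add: flux_def algebra_simps)
  moreover have "(\<lambda>x. - (of_real (p x) * flux a b p ?f x)) \<in> borel_measurable (meas a b)"
    by (intro m sq_integrable_minus mult_sq_integrable[OF p ab] flux_sq_integrable f)
  ultimately have "prim a b g = prim a b (\<lambda>x. - (of_real (p x) * flux a b p ?f x))"
    by (rule prim_cong_AE[OF m[OF sq(2)], rotated])
  moreover have "prim a b (\<lambda>x. - (of_real (p x) * flux a b p ?f x)) x = - potential a b p ?f x" for x
    unfolding potential_def using prim_scale[of a b "-1" "\<lambda>x. of_real (p x) * flux a b p ?f x" x] by simp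
  ultimately have "AE x in meas a b. u x = potential a b p ?f x"
    using u(1) by simp
  then have "U = ae_class (meas a b) (potential a b p ?f)" unfolding eq by (rule ae_class_cong)
  with that f Vf show thesis by blast
qed

lemma A_op_inverse_eq:
  assumes "p \<in> coeffs_L a b" "a < b"
  shows "(A_op a b p)\<inverse> = induced_op (meas a b) (potential a b p)"
proof (intro equalityI subrelI)
  show "(V, U) \<in> induced_op (meas a b) (potential a b p)" if "(V, U) \<in> (A_op a b p)\<inverse>" for V U
  proof -
    from that have "(U, V) \<in> A_op a b p" by simp
    then obtain f where "f \<in> sq_integrable (meas a b)" "V = ae_class (meas a b) f"
      "U = ae_class (meas a b) (potential a b p f)"
      by (rule A_op_imp_solution[OF assms])
    then show ?thesis unfolding induced_op_def by blast
  qed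
  show "(V, U) \<in> (A_op a b p)\<inverse>" if "(V, U) \<in> induced_op (meas a b) (potential a b p)" for V U
    using that solution_in_A_op(1)[OF assms] unfolding induced_op_def by blast
qed

lemma neg_flux_op_eq:
  assumes p: "p \<in> coeffs_L a b" and ab: "a < b"
  shows "neg_flux_op a b p = induced_op (meas a b) (flux a b p)"
proof (intro equalityI subrelI)
  let ?G = "\<lambda>f. ae_class (meas a b) (\<lambda>x. - (of_real (p x) * flux a b p f x))"
  let ?H = "\<lambda>f. ae_class (meas a b) (\<lambda>x. - flux a b p f x)"
  have scale: "l2_scale (meas a b) (-1) (?H f) = ae_class (meas a b) (flux a b p f)"
    if f: "f \<in> sq_integrable (meas a b)" for f
    using l2_scale_ae_class[OF sq_integrable_measurable[OF sq_integrable_minus[OF flux_sq_integrable[OF f]]], of "-1"]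
    by simp
  show "(V, Y) \<in> induced_op (meas a b) (flux a b p)" if "(V, Y) \<in> neg_flux_op a b p" for V Y
  proof -
    from that obtain U G H where A: "(U, V) \<in> A_op a b p" and D: "(U, G) \<in> D_adj a b"
      and GH: "(G, H) \<in> op_mult (meas a b) (\<lambda>x. 1 / p x)" and Y: "Y = l2_scale (meas a b) (-1) H"
      unfolding neg_flux_op_def op_uminus_def by blast
    obtain f where f: "f \<in> sq_integrable (meas a b)" "V = ae_class (meas a b) f"
      "U = ae_class (meas a b) (potential a b p f)"
      using A_op_imp_solution[OF p ab A] .
    note sol = solution_in_A_op[OF p ab f(1)]
    have "G = ?G f" using D_adj_unique[OF D _ ab] sol(2) f(3) by blast
    then have "H = ?H f" using GH sol(3) by (simp add: op_mult_def)
    then show ?thesis using f scale[OF f(1)] Y unfolding induced_op_def by blast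
  qed
  show "(V, Y) \<in> neg_flux_op a b p" if VY: "(V, Y) \<in> induced_op (meas a b) (flux a b p)" for V Y
  proof -
    from VY obtain f where f: "f \<in> sq_integrable (meas a b)" "V = ae_class (meas a b) f"
      "Y = ae_class (meas a b) (flux a b p f)" unfolding induced_op_def by blast
    note sol = solution_in_A_op[OF p ab f(1)]
    have "(V, ?H f) \<in> (A_op a b p)\<inverse> O D_adj a b O op_mult (meas a b) (\<lambda>x. 1 / p x)"
      using sol f(2) by blast
    moreover have "Y = l2_scale (meas a b) (-1) (?H f)" using scale[OF f(1)] f(3) by simp
    ultimately show ?thesis unfolding neg_flux_op_def op_uminus_def by blast
  qed
qed

section \<open>Norm convergence\<close>

text \<open>
  The operator norm is squeezed between zero and \<open>\<delta> n\<close>. Finitely many indices do not matter for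
  the limit, and the sequences of interest start at index one.
\<close>

lemma op_tendsto_induced:
  assumes t: "\<And>n. n \<ge> 1 \<Longrightarrow> T n = induced_op M (t n) \<and> l2_bounded_map M (K n) (t n)"
    and s: "l2_bounded_map M K' s"
    and le: "\<And>n f. n \<ge> 1 \<Longrightarrow> f \<in> sq_integrable M \<Longrightarrow>
      sqrt (sqn M (\<lambda>x. t n f x - s f x)) \<le> \<delta> n * sqrt (sqn M f)"
    and \<delta>: "\<And>n. 0 \<le> \<delta> n" "\<delta> \<longlonglongrightarrow> 0"
  shows "op_tendsto M T (induced_op M s)"
  unfolding op_tendsto_def
proof (rule tendsto_sandwich[OF _ _ tendsto_const \<delta>(2)])
  have "0 \<le> op_norm M (op_diff M (T n) (induced_op M s))
      \<and> op_norm M (op_diff M (T n) (induced_op M s)) \<le> \<delta> n" if "n \<ge> 1" for n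
  proof -
    have T: "T n = induced_op M (t n)" and b: "l2_bounded_map M (K n) (t n)" using t[OF that] by auto
    show ?thesis
      unfolding T using op_norm_diff_induced_le[OF b s le[OF that] \<delta>(1)] by blast
  qed
  then show "\<forall>\<^sub>F n in sequentially. 0 \<le> op_norm M (op_diff M (T n) (induced_op M s))"
    "\<forall>\<^sub>F n in sequentially. op_norm M (op_diff M (T n) (induced_op M s)) \<le> \<delta> n"
    by (auto simp: eventually_sequentially)
qed

theorem corollary6p0p5:
  fixes a b :: real
    and p_inf :: "real \<Rightarrow> real"
    and p :: "nat \<Rightarrow> real \<Rightarrow> real"
  assumes "a < b"
    and "p_inf \<in> Linf (meas a b)"
    and "\<not> (AE x in meas a b. p_inf x = 0)"
    and "AE x in meas a b. 0 \<le> p_inf x"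
    and "\<And>\<nu>. \<nu> \<ge> 1 \<Longrightarrow> p \<nu> \<in> coeffs_L a b"
    and "(\<lambda>\<nu>. L1_norm (meas a b) (\<lambda>x. p \<nu> x - p_inf x)) \<longlonglongrightarrow> 0"
  shows "(\<forall>\<nu>\<ge>1. (A_op a b (p \<nu>))\<inverse> \<in> bounded_ops (meas a b)
             \<and> neg_flux_op a b (p \<nu>) \<in> bounded_ops (meas a b))
    \<and> B_op a b p_inf \<in> bounded_ops (meas a b)
    \<and> C_op a b p_inf \<in> bounded_ops (meas a b)
    \<and> op_tendsto (meas a b) (\<lambda>\<nu>. (A_op a b (p \<nu>))\<inverse>) (B_op a b p_inf)
    \<and> op_tendsto (meas a b) (\<lambda>\<nu>. neg_flux_op a b (p \<nu>)) (C_op a b p_inf)"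
proof -
  note ab = assms(1)
  let ?N = "L1_norm (meas a b)"
  let ?d = "\<lambda>\<nu>. ?N (\<lambda>x. p \<nu> x - p_inf x)"
  let ?K = "\<lambda>f. sqrt (b - a) * sqrt (sqn (meas a b) f)"
  have q: "integrable (meas a b) p_inf" by (rule integrable_Linf[OF assms(2)])
  have q0: "0 < ?N p_inf" by (rule L1_norm_pos[OF q assms(3)])
  note P = coeffs_L_properties[OF assms(5) ab]
  note Bq = potential_bounded_map[OF ab q] and Cq = flux_bounded_map[OF ab q]
  note Bp = potential_bounded_map[OF ab P(1)] and Cp = flux_bounded_map[OF ab P(1)]
  note Aeq = A_op_inverse_eq[OF assms(5) ab] and Feq = neg_flux_op_eq[OF assms(5) ab]
  \<comment> \<open>A pointwise bound by a multiple of \<open>(b - a)\<^sup>1\<^sup>/\<^sup>2 \<parallel>f\<parallel>\<^sub>2\<close> costs another factor \<open>(b - a)\<^sup>1\<^sup>/\<^sup>2\<close> in \<open>L\<^sup>2\<close>.\<close>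
  have sup: "sqrt (sqn (meas a b) h) \<le> C * (b - a) * sqrt (sqn (meas a b) f)"
    if "\<And>x. cmod (h x) \<le> C * ?K f" "0 \<le> C" for h f C
  proof -
    have "sqrt (sqn (meas a b) h) \<le> sqrt (measure (meas a b) (space (meas a b))) * (C * ?K f)"
      by (rule sqn_le_of_bound[OF finite_meas that(1)]) (use ab that(2) in simp)
    also have "\<dots> = C * (sqrt (b - a) * sqrt (b - a)) * sqrt (sqn (meas a b) f)"
      by (simp only: space_lebesgue_on measure_meas[OF ab] mult_ac)
    finally show ?thesis using ab by simp
  qed
  have "op_tendsto (meas a b) (\<lambda>\<nu>. (A_op a b (p \<nu>))\<inverse>) (induced_op (meas a b) (potential a b p_inf))"
  proof (rule op_tendsto_induced[where t="\<lambda>\<nu>. potential a b (p \<nu>)" and \<delta>="\<lambda>\<nu>. 4 * ?d \<nu> * (b - a)"])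
    show "(A_op a b (p \<nu>))\<inverse> = induced_op (meas a b) (potential a b (p \<nu>)) \<and>
        l2_bounded_map (meas a b) (2 * (b - a) * ?N (p \<nu>)) (potential a b (p \<nu>))" if "\<nu> \<ge> 1" for \<nu>
      using Aeq[OF that] Bp[OF that] by simp
    show "sqrt (sqn (meas a b) (\<lambda>x. potential a b (p \<nu>) f x - potential a b p_inf f x))
        \<le> 4 * ?d \<nu> * (b - a) * sqrt (sqn (meas a b) f)"
      if "\<nu> \<ge> 1" "f \<in> sq_integrable (meas a b)" for \<nu> f
      by (rule sup) (use potential_diff_le[OF ab that(2) P(1)[OF that(1)] q q0 P(3)[OF that(1)]] in auto)
    show "(\<lambda>\<nu>. 4 * ?d \<nu> * (b - a)) \<longlonglongrightarrow> 0"
      using tendsto_mult_left_zero[OF tendsto_mult_right_zero[OF assms(6), of 4], of "b - a"] by simp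
  qed (use ab Bq in auto)
  moreover have "op_tendsto (meas a b) (\<lambda>\<nu>. neg_flux_op a b (p \<nu>)) (induced_op (meas a b) (flux a b p_inf))"
  proof (rule op_tendsto_induced[where t="\<lambda>\<nu>. flux a b (p \<nu>)" and \<delta>="\<lambda>\<nu>. 2 * ?d \<nu> / ?N p_inf * (b - a)"])
    show "neg_flux_op a b (p \<nu>) = induced_op (meas a b) (flux a b (p \<nu>)) \<and>
        l2_bounded_map (meas a b) (2 * (b - a)) (flux a b (p \<nu>))" if "\<nu> \<ge> 1" for \<nu>
      using Feq[OF that] Cp[OF that] by simp
    show "sqrt (sqn (meas a b) (\<lambda>x. flux a b (p \<nu>) f x - flux a b p_inf f x))
        \<le> 2 * ?d \<nu> / ?N p_inf * (b - a) * sqrt (sqn (meas a b) f)"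
      if "\<nu> \<ge> 1" "f \<in> sq_integrable (meas a b)" for \<nu> f
      by (rule sup) (use flux_diff_le[OF ab that(2) P(1)[OF that(1)] q q0 P(3)[OF that(1)]] in auto)
    show "(\<lambda>\<nu>. 2 * ?d \<nu> / ?N p_inf * (b - a)) \<longlonglongrightarrow> 0"
    proof -
      have "2 * x / y * z = 2 / y * z * x" for x y z :: real by simp
      then show ?thesis
        using tendsto_mult_right_zero[OF assms(6), of "2 / ?N p_inf * (b - a)"] by (simp only:)
    qed
  qed (use ab Cq in auto)
  ultimately show ?thesis
    unfolding B_op_eq[OF q] C_op_eq[OF q]
    using induced_op_bounded[OF Bq] induced_op_bounded[OF Cq] induced_op_bounded[OF Bp]
      induced_op_bounded[OF Cp] Aeq Feq by simp
qed

end
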